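(* Let $n\ge 1$ and let $\phi$ be a rational inner function on $\mathbb{D}^n$. Then the singular set $S_\phi\subseteq\mathbb{T}^n$ of $\phi$ is contained in an algebraic set in $\mathbb{C}^n$ of dimension $n-2$.
   Context: $\mathbb{D}$ is the open unit disk, $\mathbb{T}$ the unit circle. An inner function on $\mathbb{D}^n$ is a bounded holomorphic function on $\mathbb{D}^n$ whose radial boundary values have modulus one almost everywhere on $\mathbb{T}^n$; it is rational if it is a quotient of polynomials. The singular set $S_\phi$ is the set of points on $\mathbb{T}^n$ to which $\phi$ cannot be continuously extended from $\mathbb{D}^n$. An algebraic set in $\mathbb{C}^n$ is a finite intersection of zero sets of polynomials. Convention: the empty set has dimension $-1$ (relevant for $n=1$). *)

theory Defs
  imports "HOL-Analysis.Analysis"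
begin

definition polydisc :: "(complex ^ 'n) set" where
  "polydisc = {z. \<forall>i. cmod (z $ i) < 1}"

definition torus :: "(complex ^ 'n) set" where
  "torus = {z. \<forall>i. cmod (z $ i) = 1}"

text \<open>Normalised Lebesgue measure on the torus, viewed as a Borel measure on the
  ambient space that gives the complement of the torus measure zero.\<close>

definition torus_measure :: "(complex ^ 'n) measure" where
  "torus_measure =
     distr (uniform_measure lborel (cbox 0 (\<chi> i. 2 * pi))) borel
       (\<lambda>\<theta> :: real ^ 'n. \<chi> i. cis (\<theta> $ i))"

text \<open>Polynomials in \<open>CARD('n)\<close> complex variables are identified with the functions
  they induce, which is harmless over an infinite field.\<close>

definition polynomial_map :: "(complex ^ 'n \<Rightarrow> complex) \<Rightarrow> bool" where
  "polynomial_map p \<longleftrightarrow>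
     (\<exists>(A :: ('n \<Rightarrow> nat) set) c. finite A \<and>
        p = (\<lambda>z. \<Sum>a\<in>A. c a * (\<Prod>i\<in>UNIV. z $ i ^ a i)))"

definition algebraic_set :: "(complex ^ 'n) set \<Rightarrow> bool" where
  "algebraic_set V \<longleftrightarrow>
     (\<exists>P. finite P \<and> (\<forall>p\<in>P. polynomial_map p) \<and> V = {z. \<forall>p\<in>P. p z = 0})"

definition irreducible_algebraic_set :: "(complex ^ 'n) set \<Rightarrow> bool" where
  "irreducible_algebraic_set V \<longleftrightarrow>
     algebraic_set V \<and> V \<noteq> {} \<and>
     (\<forall>V1 V2. algebraic_set V1 \<longrightarrow> algebraic_set V2 \<longrightarrow> V = V1 \<union> V2 \<longrightarrow> V = V1 \<or> V = V2)"

definition irreducible_chain :: "(complex ^ 'n) set \<Rightarrow> nat \<Rightarrow> (nat \<Rightarrow> (complex ^ 'n) set) \<Rightarrow> bool" where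
  "irreducible_chain V k Z \<longleftrightarrow>
     (\<forall>i\<le>k. irreducible_algebraic_set (Z i) \<and> Z i \<subseteq> V) \<and> (\<forall>i<k. Z i \<subset> Z (Suc i))"

text \<open>Krull dimension of an algebraic set in the Zariski topology.  The inserted \<open>-1\<close>
  only matters for the empty set, in which there are no chains.  Extended reals are used
  so that the supremum exists without a boundedness proof.\<close>

definition alg_dim :: "(complex ^ 'n) set \<Rightarrow> ereal" where
  "alg_dim V = Sup (insert (- 1) {ereal (real k) | k. \<exists>Z. irreducible_chain V k Z})"

text \<open>Functions on the polydisc are total functions of which only the values on the
  polydisc matter.  Holomorphy is Frechet differentiability with a complex linear
  derivative.\<close>

definition holomorphic_polydisc :: "(complex ^ 'n \<Rightarrow> complex) \<Rightarrow> bool" where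
  "holomorphic_polydisc f \<longleftrightarrow>
     (\<forall>z\<in>polydisc. \<exists>f'. (f has_derivative f') (at z) \<and> (\<forall>c v. f' (c *s v) = c * f' v))"

definition inner_function :: "(complex ^ 'n \<Rightarrow> complex) \<Rightarrow> bool" where
  "inner_function f \<longleftrightarrow>
     holomorphic_polydisc f \<and> bounded (f ` polydisc) \<and>
     (AE \<zeta> in torus_measure.
        \<exists>l. ((\<lambda>r :: real. f (r *\<^sub>R \<zeta>)) \<longlongrightarrow> l) (at_left 1) \<and> cmod l = 1)"

text \<open>The quotient is one of rational functions: no representation in lowest terms is
  required, so the denominator may vanish at points of the polydisc (although not
  identically).\<close>

definition rational_on_polydisc :: "(complex ^ 'n \<Rightarrow> complex) \<Rightarrow> bool" where
  "rational_on_polydisc f \<longleftrightarrow>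
     (\<exists>p q. polynomial_map p \<and> polynomial_map q \<and> q \<noteq> (\<lambda>z. 0) \<and>
        (\<forall>z\<in>polydisc. q z \<noteq> 0 \<longrightarrow> f z = p z / q z))"

definition rational_inner_function :: "(complex ^ 'n \<Rightarrow> complex) \<Rightarrow> bool" where
  "rational_inner_function f \<longleftrightarrow> inner_function f \<and> rational_on_polydisc f"

definition singular_set :: "(complex ^ 'n \<Rightarrow> complex) \<Rightarrow> (complex ^ 'n) set" where
  "singular_set f =
     {\<zeta> \<in> torus. \<not> (\<exists>g. continuous_on (insert \<zeta> polydisc) g \<and> (\<forall>z\<in>polydisc. g z = f z))}"

end

theory Submission
  imports Defs "HOL-Library.Function_Algebras"
begin

text \<open>The function \<open>\<phi>\<close> is bounded, and there are polynomials with \<open>q \<noteq> 0\<close> and \<open>q * \<phi> = p\<close> on the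
  polydisc.  At a point of the torus where \<open>q\<close> does not vanish, \<open>p / q\<close>
  extends \<open>\<phi>\<close> continuously; where \<open>q\<close> does vanish, \<open>\<bar>p\<bar> \<le> M * \<bar>q\<bar>\<close> forces \<open>p\<close> to vanish too.
  Hence every such pair has the singular set among its common zeros.  For a coprime pair these
  have codimension two; this is made precise by elimination and by counting monomials.

  \<^item> \<^emph>\<open>Elimination.\<close>  Fix a variable and take a pair whose \<open>q\<close> has minimal degree in it.
    A linear relation \<open>a * p + b * q = 0\<close> with \<open>a \<noteq> 0\<close> of smaller degree would exhibit \<open>a\<close> as a smaller
    denominator, so counting coefficients yields \<open>a * p + b * q = r \<noteq> 0\<close> with \<open>r\<close> free of the variable
    (\<open>singular_set_eliminate_variable\<close>).  Doing this for every variable gives nonzero polynomials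
    \<open>r i\<close>, with \<open>r i\<close> free of the \<open>i\<close>-th variable, all vanishing on the singular set.
  \<^item> \<^emph>\<open>Upper bound.\<close>  The common zero set of the \<open>r i\<close> has dimension at most \<open>n - 2\<close>
    (\<open>chain_length_bound\<close>).  The heart is a comparison of growth rates.  On this set the leading
    monomials of the \<open>r i\<close> can be rewritten in terms of smaller ones.  A monomial divisible by none of them
    has two bounded exponents, since the leading monomial of \<open>r i\<close> does not involve the variable \<open>i\<close>;
    so there are \<open>O(N^(n - 2))\<close> of those up to weight \<open>N\<close>.  A chain \<open>Z 0 \<subset> \<dots> \<subset> Z m\<close> of irreducible
    sets on the other hand provides \<open>m\<close> polynomials, the \<open>j\<close>-th vanishing on \<open>Z j\<close> but not on
    \<open>Z (j + 1)\<close>, and these are algebraically independent on \<open>Z m\<close>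
    (\<open>chain_monomials_independent\<close>), so that their products grow like \<open>N^m\<close>.
  \<^item> \<^emph>\<open>Lower bound.\<close>  To attain the dimension \<open>n - 2\<close> when \<open>n \<ge> 2\<close>, each \<open>r i\<close> is multiplied by a
    coordinate other than the \<open>i\<close>-th, so that the zero set contains a coordinate subspace of
    codimension two, together with the flag of coordinate subspaces inside it.\<close>

section \<open>Weighted degrees of polynomial maps\<close>

definition monomial :: "('n::finite \<Rightarrow> nat) \<Rightarrow> complex ^ 'n \<Rightarrow> complex" where
  "monomial a z = (\<Prod>i\<in>UNIV. z $ i ^ a i)"

definition weight :: "('n::finite \<Rightarrow> nat) \<Rightarrow> ('n \<Rightarrow> nat) \<Rightarrow> nat" where
  "weight w a = (\<Sum>i\<in>UNIV. w i * a i)"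

text \<open>One notion of degree bound for three purposes: the weight \<open>var_weight i\<close> gives the degree in the
  \<open>i\<close>-th variable, so that bound \<open>0\<close> says that this variable does not occur; a generic positive
  weight replaces a monomial order; and an arbitrary weight recovers \<open>polynomial_map\<close>, whose
  closure properties follow from those of \<open>weight_le\<close>.\<close>

definition weight_le :: "('n::finite \<Rightarrow> nat) \<Rightarrow> nat \<Rightarrow> (complex ^ 'n \<Rightarrow> complex) \<Rightarrow> bool" where
  "weight_le w N f \<longleftrightarrow>
     (\<exists>A c. finite A \<and> (\<forall>a\<in>A. weight w a \<le> N) \<and> f = (\<lambda>z. \<Sum>a\<in>A. c a * monomial a z))"

abbreviation var_weight :: "'n \<Rightarrow> 'n \<Rightarrow> nat" where
  "var_weight i \<equiv> (\<lambda>j. if j = i then 1 else 0)"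

lemma monomial_add: "monomial (\<lambda>i. a i + b i) z = monomial a z * monomial b z"
  by (simp add: monomial_def power_add prod.distrib)

lemma weight_add: "weight w (\<lambda>i. a i + b i) = weight w a + weight w b"
  by (simp add: weight_def algebra_simps sum.distrib)

lemma weight_var: "weight (var_weight i) a = a i"
proof -
  have "weight (var_weight i) a = (\<Sum>j\<in>UNIV. if j = i then a j else 0)"
    unfolding weight_def by (rule sum.cong) auto
  then show ?thesis by simp
qed

lemma coord_le_weight:
  assumes "\<And>i. w i \<ge> 1"
  shows "a i \<le> weight w a"
proof -
  have "a i \<le> w i * a i" using assms[of i] by simp
  also have "\<dots> \<le> weight w a" unfolding weight_def by (rule member_le_sum) auto
  finally show ?thesis .
qed

text \<open>Exponents may repeat here.  All closure properties below reduce to this form, in which no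
  coefficients have to be collected.\<close>

lemma weight_le_indexed_sum:
  assumes "finite I" "\<And>i. i \<in> I \<Longrightarrow> weight w (e i) \<le> N"
  shows "weight_le w N (\<lambda>z. \<Sum>i\<in>I. c i * monomial (e i) z)"
proof -
  have "(\<Sum>i\<in>I. c i * monomial (e i) z) =
      (\<Sum>a\<in>e ` I. (\<Sum>i | i \<in> I \<and> e i = a. c i) * monomial a z)" for z
  proof -
    have "(\<Sum>i\<in>I. c i * monomial (e i) z) =
        (\<Sum>a\<in>e ` I. \<Sum>i | i \<in> I \<and> e i = a. c i * monomial (e i) z)"
      by (rule sum.image_gen[OF assms(1)])
    also have "\<dots> = (\<Sum>a\<in>e ` I. (\<Sum>i | i \<in> I \<and> e i = a. c i) * monomial a z)"
      by (rule sum.cong) (auto simp: sum_distrib_right)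
    finally show ?thesis .
  qed
  then have "(\<lambda>z. \<Sum>i\<in>I. c i * monomial (e i) z) =
      (\<lambda>z. \<Sum>a\<in>e ` I. (\<Sum>i | i \<in> I \<and> e i = a. c i) * monomial a z)" by (rule ext)
  then show ?thesis unfolding weight_le_def using assms
    by (intro exI[of _ "e ` I"] exI[of _ "\<lambda>a. \<Sum>i | i \<in> I \<and> e i = a. c i"]) auto
qed

lemma weight_le_mono: "weight_le w N f \<Longrightarrow> N \<le> M \<Longrightarrow> weight_le w M f"
  unfolding weight_le_def by (elim exE conjE, intro exI conjI) (auto intro: le_trans)

lemma weight_le_monomial: "weight w a \<le> N \<Longrightarrow> weight_le w N (\<lambda>z. c * monomial a z)"
  using weight_le_indexed_sum[of "{()}" w "\<lambda>_. a" N "\<lambda>_. c"] by simp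

lemma weight_le_const: "weight_le w N (\<lambda>z. c)"
  using weight_le_monomial[of w "\<lambda>_. 0" N c] by (simp add: weight_def monomial_def)

lemma weight_le_coord: "w i \<le> N \<Longrightarrow> weight_le w N (\<lambda>z. z $ i)"
proof -
  assume "w i \<le> N"
  have "monomial (var_weight i) z = z $ i" for z :: "complex ^ 'a"
  proof -
    have "monomial (var_weight i) z = (\<Prod>j\<in>UNIV. if j = i then z $ j else 1)"
      unfolding monomial_def by (rule prod.cong) auto
    then show ?thesis by simp
  qed
  moreover have "weight w (var_weight i) = w i"
    using weight_var[of i w] by (simp add: weight_def mult.commute)
  ultimately show ?thesis
    using weight_le_monomial[of w "var_weight i" N 1] \<open>w i \<le> N\<close> by simp
qed

lemma weight_le_add:
  assumes "weight_le w N f" "weight_le w N g"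
  shows "weight_le w N (\<lambda>z. f z + g z)"
proof -
  obtain A c where A: "finite A" "\<forall>a\<in>A. weight w a \<le> N" "f = (\<lambda>z. \<Sum>a\<in>A. c a * monomial a z)"
    using assms(1) unfolding weight_le_def by blast
  obtain B d where B: "finite B" "\<forall>a\<in>B. weight w a \<le> N" "g = (\<lambda>z. \<Sum>a\<in>B. d a * monomial a z)"
    using assms(2) unfolding weight_le_def by blast
  have "weight_le w N (\<lambda>z. \<Sum>i\<in>A <+> B. (case i of Inl a \<Rightarrow> c a | Inr a \<Rightarrow> d a) *
      monomial (case i of Inl a \<Rightarrow> a | Inr a \<Rightarrow> a) z)"
    by (rule weight_le_indexed_sum) (use A B in auto)
  then show ?thesis using A B by (simp add: sum.Plus)
qed

lemma weight_le_mult: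
  assumes "weight_le w N f" "weight_le w M g"
  shows "weight_le w (N + M) (\<lambda>z. f z * g z)"
proof -
  obtain A c where A: "finite A" "\<forall>a\<in>A. weight w a \<le> N" "f = (\<lambda>z. \<Sum>a\<in>A. c a * monomial a z)"
    using assms(1) unfolding weight_le_def by blast
  obtain B d where B: "finite B" "\<forall>a\<in>B. weight w a \<le> M" "g = (\<lambda>z. \<Sum>a\<in>B. d a * monomial a z)"
    using assms(2) unfolding weight_le_def by blast
  have "weight_le w (N + M) (\<lambda>z. \<Sum>i\<in>A \<times> B. (c (fst i) * d (snd i)) *
      monomial (\<lambda>j. fst i j + snd i j) z)"
    by (rule weight_le_indexed_sum) (use A B in \<open>auto simp: weight_add intro: add_mono\<close>)
  moreover have "(\<Sum>i\<in>A \<times> B. (c (fst i) * d (snd i)) * monomial (\<lambda>j. fst i j + snd i j) z) = f z * g z" for z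
    by (simp add: A B sum_product sum.cartesian_product monomial_add case_prod_unfold mult_ac)
  ultimately show ?thesis by simp
qed

lemma weight_le_cmult: "weight_le w N f \<Longrightarrow> weight_le w N (\<lambda>z. c * f z)"
  using weight_le_mult[OF weight_le_const[of w 0 c], of N f] by simp

lemma weight_le_uminus: "weight_le w N f \<Longrightarrow> weight_le w N (\<lambda>z. - f z)"
  using weight_le_cmult[of w N f "-1"] by simp

lemma weight_le_diff:
  assumes "weight_le w N f" "weight_le w N g"
  shows "weight_le w N (\<lambda>z. f z - g z)"
  using weight_le_add[OF assms(1) weight_le_uminus[OF assms(2)]] by simp

lemma weight_le_sum:
  assumes "\<And>i. i \<in> I \<Longrightarrow> weight_le w N (f i)"
  shows "weight_le w N (\<lambda>z. \<Sum>i\<in>I. f i z)"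
  using assms
proof (induction I rule: infinite_finite_induct)
  case (insert x F)
  then show ?case by (auto intro!: weight_le_add)
qed (auto intro: weight_le_const)

lemma weight_le_power:
  assumes "weight_le w N f"
  shows "weight_le w (m * N) (\<lambda>z. f z ^ m)"
proof (induction m)
  case 0 show ?case using weight_le_const[of w 0 1] by simp
next
  case (Suc m)
  then show ?case using weight_le_mult[OF assms Suc] by simp
qed

lemma polynomial_map_iff_weight_le:
  "polynomial_map f \<longleftrightarrow> (\<exists>N. weight_le w N f)"
proof
  assume "polynomial_map f"
  then obtain A c where A: "finite A" "f = (\<lambda>z. \<Sum>a\<in>A. c a * monomial a z)"
    unfolding polynomial_map_def monomial_def by blast
  then have "weight_le w (\<Sum>a\<in>A. weight w a) f"
    unfolding A(2) by (intro weight_le_indexed_sum) (auto intro: member_le_sum)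
  then show "\<exists>N. weight_le w N f" ..
next
  assume "\<exists>N. weight_le w N f"
  then show "polynomial_map f"
    unfolding polynomial_map_def monomial_def weight_le_def by blast
qed

lemma polynomial_map_weight_le: "weight_le w N f \<Longrightarrow> polynomial_map f"
  using polynomial_map_iff_weight_le[of f w] by blast

lemma polynomial_map_const: "polynomial_map (\<lambda>z. c)"
  and polynomial_map_coord: "polynomial_map (\<lambda>z. z $ i)"
  by (rule polynomial_map_weight_le[of "\<lambda>_. 0" 0], simp add: weight_le_const weight_le_coord)+

lemma polynomial_map_mult:
  "polynomial_map f \<Longrightarrow> polynomial_map g \<Longrightarrow> polynomial_map (\<lambda>z. f z * g z)"
  unfolding polynomial_map_iff_weight_le[where w = "\<lambda>_. 0"] by (blast intro: weight_le_mult)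

lemma polynomial_map_add:
  assumes "polynomial_map f" "polynomial_map g"
  shows "polynomial_map (\<lambda>z. f z + g z)"
proof -
  obtain N M where "weight_le (\<lambda>_. 0) N f" "weight_le (\<lambda>_. 0) M g"
    using assms unfolding polynomial_map_iff_weight_le[where w = "\<lambda>_. 0"] by blast
  then have "weight_le (\<lambda>_. 0) (max N M) f" "weight_le (\<lambda>_. 0) (max N M) g"
    by (auto intro: weight_le_mono)
  then show ?thesis by (rule polynomial_map_weight_le[OF weight_le_add])
qed

lemma polynomial_map_power: "polynomial_map f \<Longrightarrow> polynomial_map (\<lambda>z. f z ^ m)"
  unfolding polynomial_map_iff_weight_le[where w = "\<lambda>_. 0"] by (blast intro: weight_le_power)

lemma polynomial_map_sum:
  assumes "\<And>i. i \<in> I \<Longrightarrow> polynomial_map (f i)"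
  shows "polynomial_map (\<lambda>z. \<Sum>i\<in>I. f i z)"
  using assms
proof (induction I rule: infinite_finite_induct)
  case (insert x F)
  then show ?case by (auto intro!: polynomial_map_add)
qed (auto intro: polynomial_map_const)

lemma continuous_on_polynomial_map:
  assumes "polynomial_map f"
  shows "continuous_on S f"
proof -
  obtain A c where "f = (\<lambda>z. \<Sum>a\<in>A. c a * (\<Prod>i\<in>UNIV. z $ i ^ a i))"
    using assms unfolding polynomial_map_def by blast
  then show ?thesis by (auto intro!: continuous_intros)
qed

section \<open>Zeros of polynomial maps\<close>

text \<open>Restriction to complex lines reduces the absence of zero divisors, and the fact that zero sets are
  nowhere dense, to polynomials in one variable.\<close>

lemma polynomial_map_on_line:
  assumes "polynomial_map f"
  obtains P :: "complex poly" where "\<And>t. f (u + t *s v) = poly P t"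
proof -
  obtain A c where f: "f = (\<lambda>z. \<Sum>a\<in>A. c a * (\<Prod>i\<in>UNIV. z $ i ^ a i))"
    using assms unfolding polynomial_map_def by blast
  have "f (u + t *s v) = poly (\<Sum>a\<in>A. [:c a:] * (\<Prod>i\<in>UNIV. [:u $ i, v $ i:] ^ a i)) t" for t
    by (simp add: f poly_sum poly_prod poly_power)
  then show ?thesis using that by blast
qed

lemma linear_subspace_no_zero_divisors:
  assumes lines: "\<And>u v t. u \<in> Z \<Longrightarrow> v \<in> Z \<Longrightarrow> u + t *s (v - u) \<in> Z"
    and f: "polynomial_map f" and g: "polynomial_map g"
    and fg: "\<And>z. z \<in> Z \<Longrightarrow> f z * g z = 0"
    and u: "u \<in> Z" "f u \<noteq> 0" and v: "v \<in> Z"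
  shows "g v = 0"
proof -
  obtain P where P: "\<And>t. f (u + t *s (v - u)) = poly P t"
    using polynomial_map_on_line[OF f] by blast
  obtain Q where Q: "\<And>t. g (u + t *s (v - u)) = poly Q t"
    using polynomial_map_on_line[OF g] by blast
  have "poly (P * Q) t = 0" for t
    using fg[OF lines[OF u(1) v, of t]] unfolding P Q by simp
  then have "P * Q = 0" using poly_all_0_iff_0[of "P * Q"] by simp
  moreover have "poly P 0 \<noteq> 0" using u P[of 0] by simp
  ultimately have "Q = 0" by auto
  then show ?thesis using Q[of 1] by simp
qed

lemma polynomial_maps_no_zero_divisors:
  assumes "polynomial_map f" "polynomial_map g" "f \<noteq> (\<lambda>z. 0)" "g \<noteq> (\<lambda>z. 0)"
  shows "(\<lambda>z. f z * g z) \<noteq> (\<lambda>z. 0)"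
proof
  assume eq: "(\<lambda>z. f z * g z) = (\<lambda>z. 0)"
  obtain u where "f u \<noteq> 0" using assms by auto
  then have "g v = 0" for v
    using linear_subspace_no_zero_divisors[of UNIV f g u v] assms fun_cong[OF eq] by simp
  then show False using assms by auto
qed

lemma polynomial_map_zero_on_open:
  assumes f: "polynomial_map f" and U: "open U" "u \<in> U" and z: "\<And>z. z \<in> U \<Longrightarrow> f z = 0"
  shows "f = (\<lambda>z. 0)"
proof
  fix v
  obtain P where P: "\<And>t. f (u + t *s (v - u)) = poly P t"
    using polynomial_map_on_line[OF f] by blast
  have "continuous_on UNIV (\<lambda>t::complex. u + t *s (v - u))"
    unfolding vector_scalar_mult_def by (intro continuous_intros)
  then have "open ((\<lambda>t::complex. u + t *s (v - u)) -` U)"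
    using U(1) by (simp add: continuous_on_open_vimage)
  moreover have "0 \<in> (\<lambda>t::complex. u + t *s (v - u)) -` U" using U by simp
  ultimately have "infinite ((\<lambda>t::complex. u + t *s (v - u)) -` U)"
    using not_open_singleton[of "0::complex"] finite_imp_not_open by blast
  moreover have "(\<lambda>t::complex. u + t *s (v - u)) -` U \<subseteq> {t. poly P t = 0}"
    using z by (auto simp: P[symmetric])
  ultimately have "P = 0" using poly_roots_finite finite_subset by blast
  then show "f v = 0" using P[of 1] by simp
qed

lemma continuous_zero_off_hypersurface:
  fixes g :: "complex ^ 'n \<Rightarrow> complex"
  assumes U: "open U" and g: "continuous_on U g"
    and f: "polynomial_map f" "f \<noteq> (\<lambda>z. 0)"
    and z: "\<And>z. z \<in> U \<Longrightarrow> f z \<noteq> 0 \<Longrightarrow> g z = 0" and u: "u \<in> U"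
  shows "g u = 0"
proof (rule ccontr)
  assume "g u \<noteq> 0"
  have "open (U \<inter> g -` (- {0}))"
    using continuous_open_preimage[OF g U] by blast
  then have "f = (\<lambda>z. 0)"
    by (rule polynomial_map_zero_on_open[OF f(1), of _ u]) (use z u \<open>g u \<noteq> 0\<close> in auto)
  then show False using f by simp
qed

section \<open>Linear systems over an integral domain\<close>

text \<open>Fraction-free Gaussian elimination: a homogeneous system with more unknowns than equations has a
  nontrivial solution over the domain of its coefficients.  The domain is a subset of a ring that
  may itself have zero divisors, so that it can consist of polynomial maps inside the ring of all
  functions.\<close>

lemma homogeneous_system_solvable:
  fixes B :: "'a::comm_ring_1 set" and M :: "'g \<Rightarrow> 't \<Rightarrow> 'a"
  assumes B: "1 \<in> B" "\<And>x y. x \<in> B \<Longrightarrow> y \<in> B \<Longrightarrow> x - y \<in> B"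
      "\<And>x y. x \<in> B \<Longrightarrow> y \<in> B \<Longrightarrow> x * y \<in> B"
      "\<And>x y. x \<in> B \<Longrightarrow> y \<in> B \<Longrightarrow> x * y = 0 \<Longrightarrow> x = 0 \<or> y = 0"
    and "finite T" "finite G" "card T < card G" "\<And>g t. g \<in> G \<Longrightarrow> t \<in> T \<Longrightarrow> M g t \<in> B"
  shows "\<exists>x. (\<forall>g\<in>G. x g \<in> B) \<and> (\<exists>g\<in>G. x g \<noteq> 0) \<and> (\<forall>t\<in>T. (\<Sum>g\<in>G. x g * M g t) = 0)"
  using assms(5-8)
proof (induction T arbitrary: G M rule: finite_induct)
  case empty
  then have "G \<noteq> {}" by auto
  then show ?case using B(1) by (intro exI[of _ "\<lambda>_. 1"]) auto
next
  case (insert t T)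
  have zero: "0 \<in> B" using B(2)[OF B(1) B(1)] by simp
  have sumB: "(\<Sum>g\<in>F. h g) \<in> B" if "\<And>g. g \<in> F \<Longrightarrow> h g \<in> B" for F :: "'g set" and h
    using that
  proof (induction F rule: infinite_finite_induct)
    case (insert g F)
    have "h g - (0 - sum h F) \<in> B" using insert by (intro B(2)) (auto intro: zero)
    then show ?case using insert by simp
  qed (auto intro: zero)
  show ?case
  proof (cases "\<forall>g\<in>G. M g t = 0")
    case True
    have "card T < card G" using insert.prems insert.hyps by simp
    then obtain x where x: "\<forall>g\<in>G. x g \<in> B" "\<exists>g\<in>G. x g \<noteq> 0" "\<forall>t\<in>T. (\<Sum>g\<in>G. x g * M g t) = 0"
      using insert.IH[of G M] insert.prems by auto
    then show ?thesis using True by (intro exI[of _ x]) auto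
  next
    case False
    then obtain g0 where g0: "g0 \<in> G" "M g0 t \<noteq> 0" by auto
    define u where "u = M g0 t"
    define H where "H = G - {g0}"
    \<comment> \<open>Equation \<open>t\<close> determines the unknown \<open>g0\<close> up to the factor \<open>u\<close>; eliminate it from the others.\<close>
    have H: "finite H" "card T < card H"
      using insert.prems insert.hyps g0 by (auto simp: H_def)
    have GH: "G = insert g0 H" "g0 \<notin> H" using g0 by (auto simp: H_def)
    obtain y where y: "\<forall>g\<in>H. y g \<in> B" "\<exists>g\<in>H. y g \<noteq> 0"
        "\<forall>s\<in>T. (\<Sum>g\<in>H. y g * (u * M g s - M g t * M g0 s)) = 0"
    proof -
      have "u * M g s - M g t * M g0 s \<in> B" if "g \<in> H" "s \<in> T" for g s
        unfolding u_def by (intro B(2,3) insert.prems(3)) (use that g0 in \<open>auto simp: H_def\<close>)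
      then show thesis
        using insert.IH[of H "\<lambda>g s. u * M g s - M g t * M g0 s", OF H] that by blast
    qed
    define x where "x g = (if g = g0 then - (\<Sum>g\<in>H. y g * M g t) else u * y g)" for g
    have xH: "(\<Sum>g\<in>G. x g * M g s) = x g0 * M g0 s + (\<Sum>g\<in>H. u * y g * M g s)" for s
    proof -
      have "(\<Sum>g\<in>H. x g * M g s) = (\<Sum>g\<in>H. u * y g * M g s)"
        by (rule sum.cong) (use GH in \<open>auto simp: x_def\<close>)
      then show ?thesis using GH H by simp
    qed
    have uB: "u \<in> B" using insert.prems(3) g0 by (simp add: u_def)
    have "x g0 \<in> B"
    proof -
      have "0 - (\<Sum>g\<in>H. y g * M g t) \<in> B"
        by (intro B(2) zero sumB B(3)) (use y insert.prems(3) GH in auto)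
      then show ?thesis by (simp add: x_def)
    qed
    then have "\<forall>g\<in>G. x g \<in> B" using GH y uB by (auto simp: x_def intro: B(3))
    moreover have "\<exists>g\<in>G. x g \<noteq> 0"
    proof -
      obtain g where g: "g \<in> H" "y g \<noteq> 0" using y by auto
      then have "u * y g \<noteq> 0" using B(4)[OF uB, of "y g"] y g0 by (auto simp: u_def)
      then show ?thesis using g GH by (auto simp: x_def)
    qed
    moreover have "(\<Sum>g\<in>G. x g * M g t) = 0"
    proof -
      have "(\<Sum>g\<in>H. u * y g * M g t) = (\<Sum>g\<in>H. y g * M g t) * u"
        unfolding sum_distrib_right by (rule sum.cong) (auto simp: mult_ac)
      then show ?thesis unfolding xH by (simp add: x_def u_def)
    qed
    moreover have "(\<Sum>g\<in>G. x g * M g s) = 0" if "s \<in> T" for s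
    proof -
      have "(\<Sum>g\<in>H. y g * (u * M g s - M g t * M g0 s)) = 0" using y that by blast
      moreover have "(\<Sum>g\<in>H. y g * (u * M g s - M g t * M g0 s)) =
          (\<Sum>g\<in>H. u * y g * M g s) - (\<Sum>g\<in>H. y g * M g t) * M g0 s"
        unfolding sum_distrib_right sum_subtractf[symmetric]
        by (rule sum.cong) (auto simp: algebra_simps)
      ultimately show ?thesis unfolding xH by (simp add: x_def)
    qed
    ultimately show ?thesis by (intro exI[of _ x]) auto
  qed
qed

section \<open>Irreducible algebraic sets and coordinate subspaces\<close>

lemma algebraic_set_inter_zeros:
  assumes "algebraic_set V" "polynomial_map f"
  shows "algebraic_set {z \<in> V. f z = 0}"
proof -
  obtain P where P: "finite P" "\<forall>p\<in>P. polynomial_map p" "V = {z. \<forall>p\<in>P. p z = 0}"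
    using assms(1) unfolding algebraic_set_def by blast
  then show ?thesis unfolding algebraic_set_def
    by (intro exI[of _ "insert f P"]) (use assms in auto)
qed

lemma irreducible_algebraic_set_prime:
  assumes Z: "irreducible_algebraic_set Z"
    and fg: "polynomial_map f" "polynomial_map g" "\<And>z. z \<in> Z \<Longrightarrow> f z * g z = 0"
    and u: "u \<in> Z" "f u \<noteq> 0" and v: "v \<in> Z"
  shows "g v = 0"
proof -
  have "Z = {z \<in> Z. f z = 0} \<union> {z \<in> Z. g z = 0}" using fg(3) by auto
  moreover have "algebraic_set {z \<in> Z. f z = 0}" "algebraic_set {z \<in> Z. g z = 0}"
    using Z unfolding irreducible_algebraic_set_def
    by (simp_all add: algebraic_set_inter_zeros fg(1,2))
  ultimately have "Z = {z \<in> Z. f z = 0} \<or> Z = {z \<in> Z. g z = 0}"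
    using Z unfolding irreducible_algebraic_set_def by blast
  then show ?thesis using u v by blast
qed

lemma algebraic_set_separating_polynomial:
  assumes "algebraic_set V" "u \<notin> V"
  obtains f where "polynomial_map f" "\<And>z. z \<in> V \<Longrightarrow> f z = 0" "f u \<noteq> 0"
  using assms unfolding algebraic_set_def by blast

lemma linear_subspace_irreducible:
  assumes alg: "algebraic_set Z" and ne: "Z \<noteq> {}"
    and lines: "\<And>u v t. u \<in> Z \<Longrightarrow> v \<in> Z \<Longrightarrow> u + t *s (v - u) \<in> Z"
  shows "irreducible_algebraic_set Z"
  unfolding irreducible_algebraic_set_def
proof (intro conjI alg ne allI impI)
  fix V1 V2
  assume V: "algebraic_set V1" "algebraic_set V2" "Z = V1 \<union> V2"
  show "Z = V1 \<or> Z = V2"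
  proof (rule ccontr)
    assume "\<not> (Z = V1 \<or> Z = V2)"
    then obtain u v where uv: "u \<in> Z" "u \<notin> V1" "v \<in> Z" "v \<notin> V2" using V(3) by blast
    obtain f where f: "polynomial_map f" "\<And>z. z \<in> V1 \<Longrightarrow> f z = 0" "f u \<noteq> 0"
      using algebraic_set_separating_polynomial[OF V(1) uv(2)] by blast
    obtain g where g: "polynomial_map g" "\<And>z. z \<in> V2 \<Longrightarrow> g z = 0" "g v \<noteq> 0"
      using algebraic_set_separating_polynomial[OF V(2) uv(4)] by blast
    have fg: "f z * g z = 0" if "z \<in> Z" for z using that V(3) f(2) g(2) by auto
    have "g v = 0"
      by (rule linear_subspace_no_zero_divisors[OF lines f(1) g(1) fg uv(1) f(3) uv(3)])
    then show False using g by simp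
  qed
qed

lemma coordinate_subspace_irreducible:
  "irreducible_algebraic_set {z :: complex ^ 'n. \<forall>j\<in>S. z $ j = 0}"
proof (rule linear_subspace_irreducible)
  show "algebraic_set {z :: complex ^ 'n. \<forall>j\<in>S. z $ j = 0}"
    unfolding algebraic_set_def
    by (intro exI[of _ "(\<lambda>j z. z $ j) ` S"]) (auto intro: polynomial_map_coord)
  have "0 \<in> {z :: complex ^ 'n. \<forall>j\<in>S. z $ j = 0}" by simp
  then show "{z :: complex ^ 'n. \<forall>j\<in>S. z $ j = 0} \<noteq> {}" by blast
qed simp

text \<open>The set \<open>S\<close> lists the free coordinates; freeing them one at a time gives a flag of length
  \<open>card S\<close>.  The top of the chain is part of the claim only to let the induction proceed.\<close>

lemma coordinate_subspace_chain:
  assumes "finite S" "card S = k" "{z :: complex ^ 'n. \<forall>j\<in>- S. z $ j = 0} \<subseteq> V"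
  shows "\<exists>Z. irreducible_chain V k Z \<and> Z k = {z. \<forall>j\<in>- S. z $ j = 0}"
  using assms
proof (induction k arbitrary: S)
  case 0
  then have "S = {}" by simp
  with 0 show ?case unfolding irreducible_chain_def
    by (intro exI[of _ "\<lambda>_. {z. \<forall>j\<in>- S. z $ j = 0}"])
      (use coordinate_subspace_irreducible[of "- S"] in auto)
next
  case (Suc k)
  then obtain s T where T: "S = insert s T" "s \<notin> T" "card T = k" "finite T"
    by (metis card_Suc_eq finite_insert)
  let ?L = "\<lambda>S. {z :: complex ^ 'n. \<forall>j\<in>- S. z $ j = 0}"
  have sub: "?L T \<subseteq> ?L S" using T by auto
  obtain Z where Z: "irreducible_chain V k Z" "Z k = ?L T"
    using Suc.IH[OF T(4,3) subset_trans[OF sub Suc.prems(3)]] by blast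
  have "axis s 1 \<in> ?L S" using T by (auto simp: axis_def)
  moreover have "axis s 1 \<notin> ?L T" using T by (auto simp: axis_def)
  ultimately have psub: "?L T \<subset> ?L S" using sub by blast
  have "irreducible_chain V (Suc k) (Z(Suc k := ?L S))"
    using Z psub Suc.prems(3) coordinate_subspace_irreducible[of "- S"]
    unfolding irreducible_chain_def by (auto simp: le_Suc_eq less_Suc_eq)
  moreover have "(Z(Suc k := ?L S)) (Suc k) = ?L S" by (rule fun_upd_same)
  ultimately show ?case by blast
qed

section \<open>Algebraic independence along a chain\<close>

text \<open>The product of powers of \<open>f 0, \<dots>, f (k - 1)\<close> for a list of \<open>k\<close> exponents.  The head of the list
  belongs to the last function, the one attached to the top of the chain, so that the list can be
  shortened together with the chain.\<close>

primrec chain_monomial :: "(nat \<Rightarrow> 'z \<Rightarrow> complex) \<Rightarrow> nat list \<Rightarrow> 'z \<Rightarrow> complex" where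
  "chain_monomial f [] z = 1"
| "chain_monomial f (m # ms) z = f (length ms) z ^ m * chain_monomial f ms z"

lemma polynomial_map_chain_monomial:
  "(\<And>j. j < length ms \<Longrightarrow> polynomial_map (f j)) \<Longrightarrow> polynomial_map (chain_monomial f ms)"
proof (induction ms)
  case Nil
  then show ?case using polynomial_map_const[of 1] by simp
next
  case (Cons m ms)
  then have "polynomial_map (\<lambda>z. f (length ms) z ^ m * chain_monomial f ms z)"
    by (intro polynomial_map_mult polynomial_map_power) auto
  then show ?case by simp
qed

lemma weight_le_chain_monomial:
  assumes "\<And>j. j < length ms \<Longrightarrow> weight_le w D (f j)" "\<And>m. m \<in> set ms \<Longrightarrow> m \<le> M"
  shows "weight_le w (length ms * (M * D)) (chain_monomial f ms)"
  using assms
proof (induction ms)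
  case Nil
  then show ?case using weight_le_const[of w 0 1] by simp
next
  case (Cons m ms)
  have le: "weight_le w (m * D + length ms * (M * D))
      (\<lambda>z. f (length ms) z ^ m * chain_monomial f ms z)"
    by (intro weight_le_mult weight_le_power) (use Cons in auto)
  have "m * D \<le> M * D" using Cons.prems(2)[of m] by simp
  then have "weight_le w (length (m # ms) * (M * D))
      (\<lambda>z. f (length ms) z ^ m * chain_monomial f ms z)"
    by (intro weight_le_mono[OF le]) simp
  then show ?case by simp
qed

text \<open>The elementary half of the characterisation of Krull dimension by Coquand and Lombardi.  In a
  relation on \<open>Z (k + 1)\<close>, the lowest power of the top function \<open>f k\<close> can be cancelled because
  \<open>Z (k + 1)\<close> is irreducible.  Restricting what remains to \<open>Z k\<close>, where \<open>f k\<close> vanishes, leaves only the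
  terms in which \<open>f k\<close> had this lowest power, and these form a shorter relation on \<open>Z k\<close>.\<close>

lemma chain_monomials_independent:
  assumes "irreducible_chain V k Z"
    and "\<And>j. j < k \<Longrightarrow> polynomial_map (f j)"
    and "\<And>j z. j < k \<Longrightarrow> z \<in> Z j \<Longrightarrow> f j z = 0"
    and "\<And>j. j < k \<Longrightarrow> \<exists>z\<in>Z (Suc j). f j z \<noteq> 0"
    and "finite G" "\<And>g. g \<in> G \<Longrightarrow> length g = k"
    and "\<And>z. z \<in> Z k \<Longrightarrow> (\<Sum>g\<in>G. c g * chain_monomial f g z) = 0"
    and "g \<in> G"
  shows "c g = 0"
  using assms
proof (induction k arbitrary: G c g)
  case 0
  have "G = {[]}" using "0.prems"(6,8) by auto
  moreover obtain z where "z \<in> Z 0"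
    using "0.prems"(1) unfolding irreducible_chain_def irreducible_algebraic_set_def by auto
  ultimately show ?case using "0.prems"(7)[of z] "0.prems"(8) by simp
next
  case (Suc k)
  have len: "length g = Suc k" if "g \<in> G" for g using Suc.prems(6) that .
  have Zk: "irreducible_algebraic_set (Z (Suc k))" "Z k \<subseteq> Z (Suc k)" "irreducible_chain V k Z"
    using Suc.prems(1) unfolding irreducible_chain_def by auto
  have fk: "polynomial_map (f k)" using Suc.prems(2) by simp
  show ?case
  proof (rule ccontr)
    assume "c g \<noteq> 0"
    define H where "H = {g \<in> G. c g \<noteq> 0}"
    have H: "finite H" "H \<noteq> {}" using Suc.prems(5,8) \<open>c g \<noteq> 0\<close> by (auto simp: H_def)
    \<comment> \<open>The lowest power of \<open>f k\<close> that occurs; \<open>h\<close> is the relation after its cancellation.\<close>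
    define m where "m = Min (hd ` H)"
    have m: "m \<le> hd g" if "g \<in> H" for g using H that by (simp add: m_def)
    define h where "h z = (\<Sum>g\<in>H. c g * f k z ^ (hd g - m) * chain_monomial f (tl g) z)" for z
    have poly_h: "polynomial_map h"
      unfolding h_def[abs_def]
      by (intro polynomial_map_sum polynomial_map_mult polynomial_map_power polynomial_map_const
          polynomial_map_chain_monomial fk Suc.prems(2)) (auto simp: H_def len)
    have "f k z ^ m * h z = 0" if "z \<in> Z (Suc k)" for z
    proof -
      have term_eq: "f k z ^ m * (c g * f k z ^ (hd g - m) * chain_monomial f (tl g) z) =
          c g * chain_monomial f g z" if "g \<in> H" for g
      proof -
        obtain a as where g: "g = a # as" "length as = k"
          using len[of g] \<open>g \<in> H\<close> by (cases g) (auto simp: H_def)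
        have "f k z ^ a = f k z ^ m * f k z ^ (a - m)"
          using m[OF \<open>g \<in> H\<close>] g by (simp add: power_add[symmetric])
        then show ?thesis using g by simp
      qed
      have "f k z ^ m * h z = (\<Sum>g\<in>H. c g * chain_monomial f g z)"
        unfolding h_def sum_distrib_left by (rule sum.cong) (auto simp only: term_eq)
      also have "\<dots> = (\<Sum>g\<in>G. c g * chain_monomial f g z)"
        by (rule sum.mono_neutral_left) (use Suc.prems(5) in \<open>auto simp: H_def\<close>)
      finally show ?thesis using Suc.prems(7)[OF that] by simp
    qed
    moreover obtain u where "u \<in> Z (Suc k)" "f k u ^ m \<noteq> 0" using Suc.prems(4)[of k] by auto
    ultimately have h0: "h z = 0" if "z \<in> Z (Suc k)" for z
      by (intro irreducible_algebraic_set_prime[OF Zk(1) polynomial_map_power[OF fk, of m] poly_h])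
        (use that in auto)
    \<comment> \<open>The exponents that survive setting \<open>f k = 0\<close> in \<open>h\<close>.\<close>
    define H' where "H' = tl ` {g \<in> H. hd g = m}"
    have cons: "g = m # tl g" if "g \<in> H" "hd g = m" for g
      using that len[of g] by (cases g) (auto simp: H_def)
    have inj: "inj_on tl {g \<in> H. hd g = m}"
      by (rule inj_onI) (metis (mono_tags, lifting) cons mem_Collect_eq)
    have "(\<Sum>g\<in>H'. c (m # g) * chain_monomial f g z) = 0" if "z \<in> Z k" for z
    proof -
      have fz: "f k z = 0" using Suc.prems(3)[of k z] that by simp
      have "(\<Sum>g\<in>H'. c (m # g) * chain_monomial f g z) =
          (\<Sum>g\<in>{g \<in> H. hd g = m}. c (m # tl g) * chain_monomial f (tl g) z)"
        unfolding H'_def by (subst sum.reindex[OF inj]) simp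
      also have "\<dots> = (\<Sum>g\<in>{g \<in> H. hd g = m}. c g * f k z ^ (hd g - m) * chain_monomial f (tl g) z)"
        by (rule sum.cong) (auto simp flip: cons)
      also have "\<dots> = h z"
        unfolding h_def
        by (rule sum.mono_neutral_left) (use H m fz in \<open>auto simp: power_0_left le_antisym\<close>)
      finally show ?thesis using h0 that Zk(2) by auto
    qed
    note vanish = this
    have "m \<in> hd ` H" unfolding m_def by (intro Min_in) (use H in auto)
    then obtain g1 where g1: "g1 \<in> H" "hd g1 = m" by (metis imageE)
    have "c (m # tl g1) = 0"
    proof (rule Suc.IH[where G = H' and c = "\<lambda>g. c (m # g)"])
      show "irreducible_chain V k Z" by (rule Zk)
      show "finite H'" using H by (simp add: H'_def)
      show "tl g1 \<in> H'" using g1 by (auto simp: H'_def)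
      show "length g = k" if "g \<in> H'" for g using that len by (auto simp: H'_def H_def)
    qed (use Suc.prems(2-4) vanish in auto)
    then show False using g1 cons[of g1] by (simp add: H_def)
  qed
qed

section \<open>Standard monomials and their number\<close>

text \<open>A weight with distinct values on a finite set of exponents serves as a monomial order on it.
  The weights are built one coordinate at a time: each new one exceeds all weights attained so far,
  so that the exponents can be read off as digits in a mixed radix.\<close>

lemma separating_weight:
  assumes "finite E"
  shows "\<exists>w :: 'n::finite \<Rightarrow> nat. (\<forall>i. 1 \<le> w i) \<and> inj_on (weight w) E"
proof -
  have "\<exists>w :: 'n \<Rightarrow> nat. (\<forall>i. 1 \<le> w i) \<and> (\<forall>a\<in>E. \<forall>b\<in>E.
      (\<Sum>i\<in>S. w i * a i) = (\<Sum>i\<in>S. w i * b i) \<longrightarrow> (\<forall>i\<in>S. a i = b i))" if "finite S" for S :: "'n set"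
    using that
  proof (induction S rule: finite_induct)
    case empty
    show ?case by (intro exI[of _ "\<lambda>_. 1"]) simp
  next
    case (insert j S)
    then obtain w where w: "\<forall>i. 1 \<le> w i" "\<forall>a\<in>E. \<forall>b\<in>E.
      (\<Sum>i\<in>S. w i * a i) = (\<Sum>i\<in>S. w i * b i) \<longrightarrow> (\<forall>i\<in>S. a i = b i)" by blast
    define s where "s a = (\<Sum>i\<in>S. w i * a i)" for a
    define W where "W = Suc (\<Sum>a\<in>E. s a)"
    have W0: "W \<noteq> 0" by (simp add: W_def)
    have sW: "s a < W" if "a \<in> E" for a
      using member_le_sum[of a E s] that assms by (simp add: W_def less_Suc_eq_le)
    define v where "v = w(j := W)"
    have sum_v: "(\<Sum>i\<in>insert j S. v i * a i) = s a + W * a j" for a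
    proof -
      have "(\<Sum>i\<in>S. v i * a i) = s a"
        unfolding s_def by (rule sum.cong) (use insert.hyps in \<open>auto simp: v_def\<close>)
      then show ?thesis using insert.hyps by (simp add: v_def)
    qed
    have "\<forall>i\<in>insert j S. a i = b i"
      if "a \<in> E" "b \<in> E" "(\<Sum>i\<in>insert j S. v i * a i) = (\<Sum>i\<in>insert j S. v i * b i)" for a b
    proof -
      have eq: "s a + W * a j = s b + W * b j" using that(3) unfolding sum_v .
      have "(s a + W * a j) mod W = s a" "(s b + W * b j) mod W = s b"
        using sW that by auto
      then have "s a = s b" using eq by metis
      moreover have "a j = b j" using eq \<open>s a = s b\<close> W0 by simp
      ultimately show ?thesis using w(2) that unfolding s_def by blast
    qed
    moreover have "\<forall>i. 1 \<le> v i" using w(1) by (simp add: v_def W_def)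
    ultimately show ?case by blast
  qed
  from this[OF finite_class.finite_UNIV] obtain w :: "'n \<Rightarrow> nat" where
    w: "\<forall>i. 1 \<le> w i" "\<forall>a\<in>E. \<forall>b\<in>E. weight w a = weight w b \<longrightarrow> (\<forall>i. a i = b i)"
    unfolding weight_def by auto
  then show ?thesis by (intro exI[of _ w]) (auto intro!: inj_onI)
qed

lemma finite_weight_le:
  assumes "\<And>i. 1 \<le> w i"
  shows "finite {a :: 'n::finite \<Rightarrow> nat. weight w a \<le> N}"
proof (rule finite_subset)
  show "{a. weight w a \<le> N} \<subseteq> (\<Pi>\<^sub>E i\<in>UNIV. {..N})"
    using coord_le_weight[of w, OF assms] by (auto intro: le_trans)
qed (intro finite_PiE, auto)

text \<open>Exponents divisible by none of the leading exponents \<open>\<alpha> i\<close>, as for a Groebner basis.\<close>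

definition standard_exponents ::
  "('n::finite \<Rightarrow> nat) \<Rightarrow> ('n \<Rightarrow> 'n \<Rightarrow> nat) \<Rightarrow> nat \<Rightarrow> ('n \<Rightarrow> nat) set" where
  "standard_exponents w \<alpha> N = {b. weight w b \<le> N \<and> (\<forall>i. \<not> \<alpha> i \<le> b)}"

text \<open>Multivariate division: the leading monomial of each vanishing polynomial is a combination of
  monomials of smaller weight, so rewriting terminates and
  the standard monomials span.\<close>

lemma monomial_reduces_to_standard:
  fixes Z :: "(complex ^ 'n) set"
  assumes w: "\<And>i. 1 \<le> w i"
    and lead: "\<And>i. finite (A i)" "\<And>i. \<alpha> i \<in> A i" "\<And>i. c i (\<alpha> i) \<noteq> 0"
      "\<And>i a. a \<in> A i \<Longrightarrow> a \<noteq> \<alpha> i \<Longrightarrow> weight w a < weight w (\<alpha> i)"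
    and van: "\<And>i z. z \<in> Z \<Longrightarrow> (\<Sum>a\<in>A i. c i a * monomial a z) = 0"
    and b: "weight w b \<le> N"
  shows "\<exists>e. \<forall>z\<in>Z. monomial b z = (\<Sum>t\<in>standard_exponents w \<alpha> N. e t * monomial t z)"
  using b
proof (induction "weight w b" arbitrary: b rule: less_induct)
  case less
  have fin: "finite (standard_exponents w \<alpha> N)"
    using finite_weight_le[of w N, OF w] by (simp add: standard_exponents_def)
  show ?case
  proof (cases "\<exists>i. \<alpha> i \<le> b")
    case False
    then have "b \<in> standard_exponents w \<alpha> N" using less.prems by (simp add: standard_exponents_def)
    then have "(\<Sum>t\<in>standard_exponents w \<alpha> N. (if t = b then 1 else 0) * monomial t z) = monomial b z"
      for z using fin by (simp add: if_distrib[of "\<lambda>x. x * _"] cong: if_cong)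
    then show ?thesis by (intro exI[of _ "\<lambda>t. if t = b then 1 else 0"]) simp
  next
    case True
    then obtain i where i: "\<alpha> i \<le> b" by blast
    define d where "d j = b j - \<alpha> i j" for j
    have b_eq: "b = (\<lambda>j. d j + \<alpha> i j)" using i by (auto simp: d_def le_fun_def)
    let ?L = "A i - {\<alpha> i}"
    let ?s = "\<lambda>a j. d j + a j"
    have wt: "weight w (?s a) < weight w b" if "a \<in> ?L" for a
      unfolding b_eq weight_add using lead(4)[of a i] that by simp
    have "\<forall>a\<in>?L. \<exists>e. \<forall>z\<in>Z. monomial (?s a) z =
        (\<Sum>t\<in>standard_exponents w \<alpha> N. e t * monomial t z)"
      using less.hyps wt less.prems by (meson less_imp_le_nat le_trans)
    from bchoice[OF this] obtain e where "\<forall>a\<in>?L. \<forall>z\<in>Z. monomial (?s a) z =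
        (\<Sum>t\<in>standard_exponents w \<alpha> N. e a t * monomial t z)" ..
    then have e: "\<And>a z. a \<in> ?L \<Longrightarrow> z \<in> Z \<Longrightarrow> monomial (?s a) z =
        (\<Sum>t\<in>standard_exponents w \<alpha> N. e a t * monomial t z)" by simp
    have "monomial b z = (\<Sum>t\<in>standard_exponents w \<alpha> N.
        (\<Sum>a\<in>?L. - (c i a / c i (\<alpha> i)) * e a t) * monomial t z)" if z: "z \<in> Z" for z
    proof -
      have "c i (\<alpha> i) * monomial (\<alpha> i) z = - (\<Sum>a\<in>?L. c i a * monomial a z)"
        using van[OF z, of i] sum.remove[OF lead(1)[of i] lead(2)[of i], of "\<lambda>a. c i a * monomial a z"]
        by (simp add: eq_neg_iff_add_eq_0)
      then have "monomial (\<alpha> i) z = - (\<Sum>a\<in>?L. c i a * monomial a z) / c i (\<alpha> i)"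
        using lead(3)[of i] by (simp add: field_simps)
      also have "\<dots> = (\<Sum>a\<in>?L. - (c i a / c i (\<alpha> i)) * monomial a z)"
        by (simp add: sum_divide_distrib sum_negf)
      finally have "monomial b z = (\<Sum>a\<in>?L. - (c i a / c i (\<alpha> i)) * monomial (?s a) z)"
        by (subst b_eq) (simp add: monomial_add sum_distrib_left mult_ac)
      also have "\<dots> = (\<Sum>a\<in>?L. \<Sum>t\<in>standard_exponents w \<alpha> N.
          - (c i a / c i (\<alpha> i)) * e a t * monomial t z)"
        by (rule sum.cong) (auto simp: e z sum_distrib_left mult_ac)
      also have "\<dots> = (\<Sum>t\<in>standard_exponents w \<alpha> N. \<Sum>a\<in>?L.
          - (c i a / c i (\<alpha> i)) * e a t * monomial t z)"
        by (rule sum.swap)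
      finally show ?thesis by (simp add: sum_distrib_right)
    qed
    then show ?thesis
      by (intro exI[of _ "\<lambda>t. \<Sum>a\<in>?L. - (c i a / c i (\<alpha> i)) * e a t"] ballI)
  qed
qed

lemma weight_le_reduces_to_standard:
  fixes Z :: "(complex ^ 'n) set"
  assumes red: "\<And>b. weight w b \<le> N \<Longrightarrow>
      \<exists>e. \<forall>z\<in>Z. monomial b z = (\<Sum>t\<in>T. e t * monomial t z)"
    and f: "weight_le w N f"
  shows "\<exists>e. \<forall>z\<in>Z. f z = (\<Sum>t\<in>T. e t * monomial t z)"
proof -
  obtain A c where A: "finite A" "\<forall>a\<in>A. weight w a \<le> N" "f = (\<lambda>z. \<Sum>a\<in>A. c a * monomial a z)"
    using f unfolding weight_le_def by blast
  have "\<forall>a\<in>A. \<exists>e. \<forall>z\<in>Z. monomial a z = (\<Sum>t\<in>T. e t * monomial t z)"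
    using red A(2) by blast
  from bchoice[OF this] obtain e where
    "\<forall>a\<in>A. \<forall>z\<in>Z. monomial a z = (\<Sum>t\<in>T. e a t * monomial t z)" ..
  then have e: "\<And>a z. a \<in> A \<Longrightarrow> z \<in> Z \<Longrightarrow> monomial a z = (\<Sum>t\<in>T. e a t * monomial t z)"
    by simp
  have "f z = (\<Sum>t\<in>T. (\<Sum>a\<in>A. c a * e a t) * monomial t z)" if "z \<in> Z" for z
  proof -
    have "f z = (\<Sum>a\<in>A. \<Sum>t\<in>T. c a * e a t * monomial t z)"
      unfolding A(3) by (rule sum.cong) (auto simp: e that sum_distrib_left mult_ac)
    also have "\<dots> = (\<Sum>t\<in>T. \<Sum>a\<in>A. c a * e a t * monomial t z)" by (rule sum.swap)
    finally show ?thesis by (simp add: sum_distrib_right)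
  qed
  then show ?thesis by (intro exI[of _ "\<lambda>t. \<Sum>a\<in>A. c a * e a t"] ballI)
qed

lemma card_two_small_coordinates:
  fixes i j :: "'n::finite"
  assumes "i \<noteq> j"
  shows "finite {b :: 'n \<Rightarrow> nat. b i < K \<and> b j < K \<and> (\<forall>l. b l \<le> N)}"
    and "card {b :: 'n \<Rightarrow> nat. b i < K \<and> b j < K \<and> (\<forall>l. b l \<le> N)}
      \<le> K ^ 2 * Suc N ^ (CARD('n) - 2)"
proof -
  let ?F = "\<Pi>\<^sub>E l\<in>(UNIV :: 'n set). if l = i \<or> l = j then {..<K} else {..N}"
  have sub: "{b :: 'n \<Rightarrow> nat. b i < K \<and> b j < K \<and> (\<forall>l. b l \<le> N)} \<subseteq> ?F" by auto
  have fin: "finite ?F" by (intro finite_PiE) auto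
  show "finite {b :: 'n \<Rightarrow> nat. b i < K \<and> b j < K \<and> (\<forall>l. b l \<le> N)}"
    using finite_subset[OF sub fin] .
  have "card ?F = (\<Prod>l\<in>(UNIV :: 'n set). if l = i \<or> l = j then K else Suc N)"
    by (subst card_PiE) (auto intro!: prod.cong)
  also have "\<dots> = (\<Prod>l\<in>{i, j}. K) * (\<Prod>l\<in>UNIV - {i, j}. Suc N)"
    by (subst prod.subset_diff[of "{i, j}" UNIV]) (auto intro!: prod.cong simp: mult.commute)
  also have "\<dots> = K ^ 2 * Suc N ^ (CARD('n) - 2)"
    using assms by (simp add: card_Diff_subset power2_eq_square numeral_2_eq_2)
  finally show "card {b :: 'n \<Rightarrow> nat. b i < K \<and> b j < K \<and> (\<forall>l. b l \<le> N)}
      \<le> K ^ 2 * Suc N ^ (CARD('n) - 2)"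
    using card_mono[OF fin sub] by simp
qed

text \<open>An exponent not divisible by \<open>\<alpha> i\<close> has a small entry in some position \<open>j\<close> where \<open>\<alpha> i\<close> is positive,
  so \<open>j \<noteq> i\<close>.  A first small position \<open>j\<close> comes from any \<open>i\<close>, and \<open>\<alpha> j\<close> then gives a second one
  different from \<open>j\<close>.\<close>

lemma card_standard_exponents:
  fixes \<alpha> :: "'n::finite \<Rightarrow> 'n \<Rightarrow> nat"
  assumes w: "\<And>i. 1 \<le> w i" and free: "\<And>i. \<alpha> i i = 0" and K: "\<And>i j. \<alpha> i j \<le> K"
  shows "card (standard_exponents w \<alpha> N)
    \<le> card {p :: 'n \<times> 'n. fst p \<noteq> snd p} * (K ^ 2 * Suc N ^ (CARD('n) - 2))"
proof -
  let ?P = "{p :: 'n \<times> 'n. fst p \<noteq> snd p}"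
  let ?S = "\<lambda>p. {b :: 'n \<Rightarrow> nat. b (fst p) < K \<and> b (snd p) < K \<and> (\<forall>l. b l \<le> N)}"
  have sub: "standard_exponents w \<alpha> N \<subseteq> (\<Union>p\<in>?P. ?S p)"
  proof
    fix b assume b: "b \<in> standard_exponents w \<alpha> N"
    have small: "\<exists>j. j \<noteq> i \<and> b j < K" for i
    proof -
      obtain j where j: "b j < \<alpha> i j"
        using b by (auto simp: standard_exponents_def le_fun_def not_le)
      then have "j \<noteq> i" using free[of i] by auto
      then show ?thesis using j K[of i j] by (intro exI[of _ j]) auto
    qed
    obtain j where j: "b j < K" using small by blast
    obtain l where l: "l \<noteq> j" "b l < K" using small by blast
    have "b m \<le> N" for m
      using coord_le_weight[of w b m, OF w] b by (simp add: standard_exponents_def)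
    then show "b \<in> (\<Union>p\<in>?P. ?S p)" using j l by (intro UN_I[of "(l, j)"]) auto
  qed
  have "card (standard_exponents w \<alpha> N) \<le> card (\<Union>p\<in>?P. ?S p)"
    by (rule card_mono[OF _ sub]) (auto intro: card_two_small_coordinates(1))
  also have "\<dots> \<le> (\<Sum>p\<in>?P. card (?S p))" by (rule card_UN_le) simp
  also have "\<dots> \<le> (\<Sum>p\<in>?P. K ^ 2 * Suc N ^ (CARD('n) - 2))"
    by (rule sum_mono) (auto intro: card_two_small_coordinates(2))
  finally show ?thesis by simp
qed

text \<open>Already \<open>M = C * (L + 1)^s\<close> is large enough, as \<open>L * M + 1 \<le> (L + 1) * (M + 1)\<close>.\<close>

lemma power_outgrows_lower_power:
  fixes C L s :: nat
  shows "\<exists>M. C * Suc (L * M) ^ s < Suc M ^ Suc s"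
proof -
  define M where "M = C * Suc L ^ s"
  have "Suc (L * M) \<le> Suc L * Suc M" by simp
  then have "C * Suc (L * M) ^ s \<le> C * (Suc L * Suc M) ^ s" by (intro mult_left_mono power_mono) auto
  also have "\<dots> = M * Suc M ^ s" by (simp only: M_def power_mult_distrib mult.assoc)
  also have "\<dots> < Suc M ^ Suc s" by simp
  finally show ?thesis by blast
qed

text \<open>If the chain were too long, its part up to \<open>m = n - 1\<close> would give \<open>m\<close> independent functions on
  \<open>Z m\<close>.  Their products with exponents up to \<open>M\<close> number \<open>(M + 1)^m\<close> and have weight at most
  \<open>N = m * D * M\<close>, while on \<open>Z m\<close> they lie in the span of the \<open>O(N^(n - 2))\<close> standard monomials.
  For large \<open>M\<close> this forces a linear relation.\<close>

lemma chain_length_bound: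
  fixes r :: "'n \<Rightarrow> complex ^ 'n \<Rightarrow> complex"
  assumes r: "\<And>i. weight_le (var_weight i) 0 (r i)" "\<And>i. r i \<noteq> (\<lambda>z. 0)"
    and Z: "irreducible_chain {z. \<forall>i. r i z = 0} k Z"
  shows "k + 2 \<le> CARD('n)"
proof (rule ccontr)
  assume "\<not> k + 2 \<le> CARD('n)"
  define m where "m = CARD('n) - 1"
  have mk: "m \<le> k" using \<open>\<not> k + 2 \<le> CARD('n)\<close> by (simp add: m_def)
  have "\<forall>i. \<exists>A c. finite A \<and> A \<noteq> {} \<and> (\<forall>a\<in>A. a i = 0 \<and> c a \<noteq> 0) \<and>
      r i = (\<lambda>z. \<Sum>a\<in>A. c a * monomial a z)"
  proof
    fix i
    obtain A c where A: "finite A" "\<forall>a\<in>A. weight (var_weight i) a \<le> 0"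
        "r i = (\<lambda>z. \<Sum>a\<in>A. c a * monomial a z)"
      using r(1)[of i] unfolding weight_le_def by blast
    have ri: "r i = (\<lambda>z. \<Sum>a\<in>{a\<in>A. c a \<noteq> 0}. c a * monomial a z)"
      unfolding A(3) by (intro ext sum.mono_neutral_right) (use A in auto)
    moreover have "{a\<in>A. c a \<noteq> 0} \<noteq> {}"
    proof
      assume empty: "{a\<in>A. c a \<noteq> 0} = {}"
      show False using r(2)[of i] ri unfolding empty by simp
    qed
    ultimately show "\<exists>A c. finite A \<and> A \<noteq> {} \<and> (\<forall>a\<in>A. a i = 0 \<and> c a \<noteq> 0) \<and>
      r i = (\<lambda>z. \<Sum>a\<in>A. c a * monomial a z)"
      using A(1,2) by (intro exI[of _ "{a\<in>A. c a \<noteq> 0}"] exI[of _ c]) (auto simp: weight_var)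
  qed
  from choice[OF this] obtain A where "\<forall>i. \<exists>c. finite (A i) \<and> A i \<noteq> {} \<and>
      (\<forall>a\<in>A i. a i = 0 \<and> c a \<noteq> 0) \<and> r i = (\<lambda>z. \<Sum>a\<in>A i. c a * monomial a z)" ..
  from choice[OF this] obtain c where Ac: "\<forall>i. finite (A i) \<and> A i \<noteq> {} \<and>
      (\<forall>a\<in>A i. a i = 0 \<and> c i a \<noteq> 0) \<and> r i = (\<lambda>z. \<Sum>a\<in>A i. c i a * monomial a z)" ..
  have A: "finite (A i)" "A i \<noteq> {}" "a \<in> A i \<Longrightarrow> a i = 0 \<and> c i a \<noteq> 0"
      "r i = (\<lambda>z. \<Sum>a\<in>A i. c i a * monomial a z)" for i a
    using spec[OF Ac, of i] by simp_all
  define E where "E = (\<Union>i. A i)"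
  have "finite E" using A(1) by (simp add: E_def)
  then obtain w :: "'n \<Rightarrow> nat" where w: "\<And>i. 1 \<le> w i" "inj_on (weight w) E"
    using separating_weight by blast
  have "\<exists>a. a \<in> A i \<and> (\<forall>b\<in>A i. b \<noteq> a \<longrightarrow> weight w b < weight w a)" for i
  proof -
    have "Max (weight w ` A i) \<in> weight w ` A i" using A by (intro Max_in) auto
    then obtain a where a: "a \<in> A i" "weight w a = Max (weight w ` A i)" by auto
    have "weight w b < weight w a" if "b \<in> A i" "b \<noteq> a" for b
    proof -
      have "weight w b \<le> weight w a" using a that A(1) by simp
      moreover have "weight w b \<noteq> weight w a"
        using w(2) a(1) that unfolding inj_on_def E_def by blast
      ultimately show ?thesis by simp
    qed
    then show ?thesis using a by blast
  qed
  then obtain \<alpha> where \<alpha>: "\<And>i. \<alpha> i \<in> A i"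
      "\<And>i b. b \<in> A i \<Longrightarrow> b \<noteq> \<alpha> i \<Longrightarrow> weight w b < weight w (\<alpha> i)" by metis
  define K where "K = (\<Sum>i\<in>UNIV. \<Sum>j\<in>UNIV. \<alpha> i j)"
  have K: "\<alpha> i j \<le> K" for i j
  proof -
    have "\<alpha> i j \<le> (\<Sum>j\<in>UNIV. \<alpha> i j)" by (rule member_le_sum) auto
    also have "\<dots> \<le> K" unfolding K_def by (rule member_le_sum[of i]) auto
    finally show ?thesis .
  qed

  have irr: "irreducible_algebraic_set (Z j)" "Z j \<subseteq> {z. \<forall>i. r i z = 0}" if "j \<le> k" for j
    using Z that unfolding irreducible_chain_def by auto
  have Zm: "irreducible_chain {z. \<forall>i. r i z = 0} m Z"
    using Z mk unfolding irreducible_chain_def by auto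
  have "\<forall>j\<in>{..<m}. \<exists>f. polynomial_map f \<and> (\<forall>z\<in>Z j. f z = 0) \<and> (\<exists>z\<in>Z (Suc j). f z \<noteq> 0)"
  proof
    fix j assume "j \<in> {..<m}"
    have "Z j \<subset> Z (Suc j)" "algebraic_set (Z j)"
      using Z mk \<open>j \<in> {..<m}\<close>
      unfolding irreducible_chain_def irreducible_algebraic_set_def by auto
    then obtain u where u: "u \<in> Z (Suc j)" "u \<notin> Z j" by blast
    obtain f where "polynomial_map f" "\<And>z. z \<in> Z j \<Longrightarrow> f z = 0" "f u \<noteq> 0"
      using algebraic_set_separating_polynomial[OF \<open>algebraic_set (Z j)\<close> u(2)] by blast
    then show "\<exists>f. polynomial_map f \<and> (\<forall>z\<in>Z j. f z = 0) \<and> (\<exists>z\<in>Z (Suc j). f z \<noteq> 0)"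
      using u(1) by (intro exI[of _ f]) auto
  qed
  from bchoice[OF this] obtain f where "\<forall>j\<in>{..<m}. polynomial_map (f j) \<and>
      (\<forall>z\<in>Z j. f j z = 0) \<and> (\<exists>z\<in>Z (Suc j). f j z \<noteq> 0)" ..
  then have f: "\<And>j. j < m \<Longrightarrow> polynomial_map (f j)"
      "\<And>j z. j < m \<Longrightarrow> z \<in> Z j \<Longrightarrow> f j z = 0"
      "\<And>j. j < m \<Longrightarrow> \<exists>z\<in>Z (Suc j). f j z \<noteq> 0"
    by simp_all
  have "\<forall>j\<in>{..<m}. \<exists>N. weight_le w N (f j)"
    using f(1) polynomial_map_iff_weight_le[of _ w] by blast
  then obtain d where d: "\<And>j. j < m \<Longrightarrow> weight_le w (d j) (f j)" by (metis lessThan_iff)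
  define D where "D = (\<Sum>j<m. d j)"
  have D: "weight_le w D (f j)" if "j < m" for j
    by (rule weight_le_mono[OF d[OF that]]) (use that in \<open>auto simp: D_def intro: member_le_sum\<close>)

  define P where "P = card {p :: 'n \<times> 'n. fst p \<noteq> snd p} * K ^ 2"
  \<comment> \<open>For \<open>n = 1\<close> there are no two distinct positions, hence no standard exponents and \<open>P = 0\<close>.\<close>
  obtain M where M: "P * Suc (m * D * M) ^ (CARD('n) - 2) < Suc M ^ m"
  proof (cases "m = 0")
    case True
    then have "CARD('n) = 1" using zero_less_card_finite[where 'a = 'n] unfolding m_def by arith
    then obtain x :: 'n where "UNIV = {x}" using card_1_singletonE by blast
    then have "{p :: 'n \<times> 'n. fst p \<noteq> snd p} = {}" by (metis (mono_tags, lifting) Collect_empty_eq UNIV_I singletonD)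
    then have "P = 0" by (simp add: P_def)
    then show ?thesis using that[of 0] by simp
  next
    case False
    then have "Suc (CARD('n) - 2) = m" by (simp add: m_def)
    then show ?thesis using power_outgrows_lower_power[of P "m * D" "CARD('n) - 2"] that by metis
  qed
  define N where "N = m * D * M"
  define T where "T = standard_exponents w \<alpha> N"
  define G where "G = {g. set g \<subseteq> {..M} \<and> length g = m}"
  have "finite T" using finite_weight_le[of w N, OF w(1)] by (simp add: T_def standard_exponents_def)
  have "finite G" unfolding G_def by (rule finite_lists_length_eq) simp
  have "card T < card G"
  proof -
    have "card T \<le> P * Suc N ^ (CARD('n) - 2)"
      using card_standard_exponents[of w \<alpha> K N, OF w(1) _ K] A(3)[OF \<alpha>(1)]
      by (simp add: T_def P_def mult.assoc)
    also have "\<dots> < Suc M ^ m" using M by (simp add: N_def)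
    also have "\<dots> = card G" unfolding G_def by (subst card_lists_length_eq) auto
    finally show ?thesis .
  qed
  have "\<forall>g\<in>G. \<exists>e. \<forall>z\<in>Z m. chain_monomial f g z = (\<Sum>t\<in>T. e t * monomial t z)"
  proof
    fix g assume g: "g \<in> G"
    have wt: "weight_le w N (chain_monomial f g)"
      using weight_le_chain_monomial[of g w D f M] g D by (auto simp: G_def N_def mult_ac)
    have red: "\<exists>e. \<forall>z\<in>Z m. monomial b z = (\<Sum>t\<in>T. e t * monomial t z)" if "weight w b \<le> N" for b
      unfolding T_def
    proof (rule monomial_reduces_to_standard[where A = A and c = c])
      show "(\<Sum>a\<in>A i. c i a * monomial a z) = 0" if "z \<in> Z m" for i z
      proof -
        have "r i z = 0" using irr(2)[OF mk] that by blast
        then show ?thesis using fun_cong[OF A(4)[of i], of z] by simp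
      qed
    qed (use w A \<alpha> that in auto)
    show "\<exists>e. \<forall>z\<in>Z m. chain_monomial f g z = (\<Sum>t\<in>T. e t * monomial t z)"
      by (rule weight_le_reduces_to_standard[where w = w and N = N, OF red wt])
  qed
  from bchoice[OF this] obtain e where "\<forall>g\<in>G. \<forall>z\<in>Z m.
      chain_monomial f g z = (\<Sum>t\<in>T. e g t * monomial t z)" ..
  then have e: "\<And>g z. g \<in> G \<Longrightarrow> z \<in> Z m \<Longrightarrow>
      chain_monomial f g z = (\<Sum>t\<in>T. e g t * monomial t z)" by simp
  have "\<exists>x. (\<forall>g\<in>G. x g \<in> UNIV) \<and> (\<exists>g\<in>G. x g \<noteq> 0) \<and>
      (\<forall>t\<in>T. (\<Sum>g\<in>G. x g * e g t) = 0)"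
    by (intro homogeneous_system_solvable \<open>finite T\<close> \<open>finite G\<close> \<open>card T < card G\<close>) auto
  then obtain x where x: "\<exists>g\<in>G. x g \<noteq> 0" "\<And>t. t \<in> T \<Longrightarrow> (\<Sum>g\<in>G. x g * e g t) = 0" by blast
  have rel: "(\<Sum>g\<in>G. x g * chain_monomial f g z) = 0" if "z \<in> Z m" for z
  proof -
    have "(\<Sum>g\<in>G. x g * chain_monomial f g z) = (\<Sum>g\<in>G. \<Sum>t\<in>T. x g * e g t * monomial t z)"
      by (rule sum.cong) (auto simp: e that sum_distrib_left mult_ac)
    also have "\<dots> = (\<Sum>t\<in>T. (\<Sum>g\<in>G. x g * e g t) * monomial t z)"
      by (subst sum.swap) (simp add: sum_distrib_right)
    finally show ?thesis using x(2) by simp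
  qed
  have "x g = 0" if "g \<in> G" for g
    by (rule chain_monomials_independent[OF Zm f \<open>finite G\<close> _ rel that]) (auto simp: G_def)
  then show False using x(1) by blast
qed

section \<open>Singular points of a bounded fraction\<close>

lemma open_polydisc: "open (polydisc :: (complex ^ 'n) set)"
proof -
  have eq: "polydisc = (\<Inter>i\<in>UNIV. {z :: complex ^ 'n. cmod (z $ i) < 1})"
    by (auto simp: polydisc_def)
  show ?thesis
    unfolding eq by (intro open_INT finite_class.finite_UNIV ballI open_Collect_less continuous_intros)
qed

lemma torus_subset_closure_polydisc: "torus \<subseteq> closure (polydisc :: (complex ^ 'n) set)"
proof
  fix \<zeta> :: "complex ^ 'n" assume "\<zeta> \<in> torus"
  then have "(1 - inverse (real (Suc k))) *\<^sub>R \<zeta> \<in> polydisc" for k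
    by (auto simp: torus_def polydisc_def field_simps)
  moreover have "(\<lambda>k. (1 - inverse (real (Suc k))) *\<^sub>R \<zeta>) \<longlonglongrightarrow> (1 - 0) *\<^sub>R \<zeta>"
    by (intro tendsto_intros LIMSEQ_inverse_real_of_nat)
  ultimately show "\<zeta> \<in> closure polydisc"
    unfolding closure_sequential by (intro exI[of _ "\<lambda>k. (1 - inverse (real (Suc k))) *\<^sub>R \<zeta>"]) simp
qed

lemma holomorphic_polydisc_continuous_on:
  assumes "holomorphic_polydisc f"
  shows "continuous_on polydisc f"
  using assms has_derivative_continuous
  unfolding holomorphic_polydisc_def continuous_on_eq_continuous_at[OF open_polydisc] by blast

text \<open>The equation is stated without division, so that it holds at the zeros of \<open>q\<close> as well and
  survives passage to the boundary.\<close>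

definition fraction_on_polydisc ::
  "(complex ^ 'n \<Rightarrow> complex) \<Rightarrow> (complex ^ 'n \<Rightarrow> complex) \<Rightarrow> (complex ^ 'n \<Rightarrow> complex) \<Rightarrow> bool" where
  "fraction_on_polydisc f p q \<longleftrightarrow> polynomial_map p \<and> polynomial_map q \<and> q \<noteq> (\<lambda>z. 0) \<and>
     (\<forall>z\<in>polydisc. q z * f z = p z)"

lemma rational_on_polydisc_fraction:
  assumes f: "continuous_on polydisc f" and "rational_on_polydisc f"
  shows "\<exists>p q. fraction_on_polydisc f p q"
proof -
  obtain p q where pq: "polynomial_map p" "polynomial_map q" "q \<noteq> (\<lambda>z. 0)"
      "\<forall>z\<in>polydisc. q z \<noteq> 0 \<longrightarrow> f z = p z / q z"
    using assms(2) unfolding rational_on_polydisc_def by blast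
  have "q z * f z - p z = 0" if "z \<in> polydisc" for z
  proof (rule continuous_zero_off_hypersurface[OF open_polydisc _ pq(2,3) _ that])
    show "continuous_on polydisc (\<lambda>z. q z * f z - p z)"
      by (intro continuous_intros f continuous_on_polynomial_map pq)
  qed (use pq(4) in auto)
  then show ?thesis using pq unfolding fraction_on_polydisc_def by auto
qed

text \<open>Which pairs represent \<open>f\<close> can be decided by polynomial identities alone, because the zeros of \<open>q\<close> are
  nowhere dense.\<close>

lemma fraction_on_polydisc_cross_multiply:
  assumes f: "continuous_on polydisc f" and pq: "fraction_on_polydisc f p q"
    and ab: "polynomial_map a" "polynomial_map b" "b \<noteq> (\<lambda>z. 0)" "\<And>z. b z * p z = a z * q z"
  shows "fraction_on_polydisc f a b"
proof -
  have q: "polynomial_map q" "q \<noteq> (\<lambda>z. 0)" "\<And>z. z \<in> polydisc \<Longrightarrow> q z * f z = p z"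
    using pq unfolding fraction_on_polydisc_def by auto
  have "b z * f z - a z = 0" if "z \<in> polydisc" for z
  proof (rule continuous_zero_off_hypersurface[OF open_polydisc _ q(1,2) _ that])
    show "continuous_on polydisc (\<lambda>z. b z * f z - a z)"
      by (intro continuous_intros f continuous_on_polynomial_map ab)
    fix z assume z: "z \<in> polydisc" "q z \<noteq> 0"
    have "q z * (b z * f z - a z) = b z * (q z * f z) - a z * q z" by (simp add: algebra_simps)
    also have "\<dots> = 0" using q(3)[OF z(1)] ab(4)[of z] by simp
    finally show "b z * f z - a z = 0" using z(2) by simp
  qed
  then show ?thesis using ab unfolding fraction_on_polydisc_def by auto
qed

text \<open>If \<open>q \<zeta> \<noteq> 0\<close>, then \<open>p / q\<close> is the missing continuous extension.  Given \<open>q \<zeta> = 0\<close>, boundedness of \<open>f\<close>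
  gives \<open>\<bar>p\<bar> \<le> M * \<bar>q\<bar>\<close> on the polydisc and, by continuity, at \<open>\<zeta>\<close>.\<close>

lemma singular_set_subset_zeros:
  assumes f: "continuous_on polydisc f" and bdd: "bounded (f ` polydisc)"
    and pq: "fraction_on_polydisc f p q" and \<zeta>: "\<zeta> \<in> singular_set f"
  shows "q \<zeta> = 0" "p \<zeta> = 0"
proof -
  have poly: "polynomial_map p" "polynomial_map q" and eq: "\<And>z. z \<in> polydisc \<Longrightarrow> q z * f z = p z"
    using pq unfolding fraction_on_polydisc_def by auto
  have torus: "\<zeta> \<in> torus" using \<zeta> unfolding singular_set_def by auto
  show q0: "q \<zeta> = 0"
  proof (rule ccontr)
    assume nz: "q \<zeta> \<noteq> 0"
    define g where "g z = (if z \<in> polydisc then f z else p z / q z)" for z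
    have "continuous_on (insert \<zeta> polydisc) g"
    proof -
      let ?U = "{z. q z \<noteq> 0}"
      have "open ?U" using continuous_on_polynomial_map[OF poly(2)] by (intro open_Collect_neq) auto
      have "continuous_on (insert \<zeta> polydisc \<inter> ?U) (\<lambda>z. p z / q z)"
        by (intro continuous_intros continuous_on_polynomial_map poly) auto
      moreover have "p z / q z = g z" if "z \<in> ?U" for z
        using that eq[of z] by (auto simp: g_def field_simps)
      ultimately have "continuous_on (insert \<zeta> polydisc \<inter> ?U) g"
        by (metis (no_types, lifting) IntD2 continuous_on_cong)
      moreover have "continuous_on polydisc g"
        using f by (rule continuous_on_eq) (simp add: g_def)
      moreover have "insert \<zeta> polydisc \<inter> ?U \<union> polydisc = insert \<zeta> polydisc" using nz by auto
      moreover have "insert \<zeta> polydisc \<inter> polydisc = polydisc" by auto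
      ultimately show ?thesis
        using continuous_on_Un_local_open[of "insert \<zeta> polydisc \<inter> ?U" polydisc g]
          openin_open_Int[OF \<open>open ?U\<close>, of "insert \<zeta> polydisc"]
          openin_open_Int[OF open_polydisc, of "insert \<zeta> polydisc"] by simp
    qed
    moreover have "\<forall>z\<in>polydisc. g z = f z" by (simp add: g_def)
    ultimately show False using \<zeta> unfolding singular_set_def by blast
  qed
  obtain M where M: "\<And>z. z \<in> polydisc \<Longrightarrow> cmod (f z) \<le> M"
    using bdd unfolding bounded_iff by auto
  have "0 \<le> M * cmod (q \<zeta>) - cmod (p \<zeta>)"
  proof (rule continuous_ge_on_closure[where S = polydisc])
    show "continuous_on (closure polydisc) (\<lambda>z. M * cmod (q z) - cmod (p z))"
      by (intro continuous_intros continuous_on_polynomial_map poly)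
    show "\<zeta> \<in> closure polydisc" using torus torus_subset_closure_polydisc by blast
    fix z :: "complex ^ 'a" assume z: "z \<in> polydisc"
    have "cmod (p z) = cmod (q z) * cmod (f z)" by (simp add: eq[OF z, symmetric] norm_mult)
    then show "0 \<le> M * cmod (q z) - cmod (p z)"
      using mult_left_mono[OF M[OF z], of "cmod (q z)"] by (simp add: mult.commute)
  qed
  then show "p \<zeta> = 0" using q0 by simp
qed

section \<open>Elimination of a variable\<close>

lemma weight_le_var_coefficients:
  assumes "weight_le (var_weight i) d f"
  obtains b where "\<And>k. weight_le (var_weight i) 0 (b k)"
    "\<And>z. f z = (\<Sum>k\<le>d. b k z * z $ i ^ k)"
proof -
  obtain A c where A: "finite A" "\<And>a. a \<in> A \<Longrightarrow> a i \<le> d" "f = (\<lambda>z. \<Sum>a\<in>A. c a * monomial a z)"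
    using assms unfolding weight_le_def weight_var by blast
  define b where "b k z = (\<Sum>a\<in>{a \<in> A. a i = k}. c a * monomial (a(i := 0)) z)" for k z
  have "weight_le (var_weight i) 0 (b k)" for k
    unfolding b_def[abs_def] by (rule weight_le_indexed_sum) (use A in \<open>auto simp: weight_var\<close>)
  moreover have "f z = (\<Sum>k\<le>d. b k z * z $ i ^ k)" for z
  proof -
    have mon: "monomial a z = monomial (a(i := 0)) z * z $ i ^ a i" for a
      unfolding monomial_def by (subst (1 2) prod.remove[of _ i]) (auto intro!: prod.cong)
    have "f z = (\<Sum>k\<le>d. \<Sum>a\<in>{a \<in> A. a i = k}. c a * monomial a z)"
      unfolding A(3) by (rule sum.group[symmetric]) (use A in auto)
    also have "\<dots> = (\<Sum>k\<le>d. b k z * z $ i ^ k)"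
    proof -
      have "c a * monomial a z = c a * monomial (a(i := 0)) z * z $ i ^ k" if "a i = k" for a k
        using mon[of a] that by simp
      then show ?thesis unfolding b_def sum_distrib_right by (intro sum.cong refl) blast
    qed
    finally show ?thesis .
  qed
  ultimately show ?thesis using that by blast
qed

lemma weight_le_var_0_upd:
  assumes "weight_le (var_weight i) 0 f"
  shows "f (\<chi> j. if j = i then t else z $ j) = f z"
proof -
  obtain A c where A: "finite A" "\<And>a. a \<in> A \<Longrightarrow> a i = 0" "f = (\<lambda>z. \<Sum>a\<in>A. c a * monomial a z)"
    using assms unfolding weight_le_def weight_var by auto
  have "monomial a (\<chi> j. if j = i then t else z $ j) = monomial a z" if "a \<in> A" for a
    unfolding monomial_def by (rule prod.cong) (use A(2)[OF that] in auto)
  then show ?thesis unfolding A(3) by simp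
qed

lemma var_coefficients_unique:
  assumes b: "\<And>k. k < d \<Longrightarrow> weight_le (var_weight i) 0 (b k)"
    and zero: "\<And>z. (\<Sum>k<d. b k z * z $ i ^ k) = 0" and k: "k < d"
  shows "b k = (\<lambda>z. 0)"
proof
  fix z
  define P where "P = (\<Sum>k<d. monom (b k z) k)"
  have "poly P t = 0" for t
  proof -
    let ?z = "\<chi> j. if j = i then t else z $ j"
    have "poly P t = (\<Sum>k<d. b k ?z * ?z $ i ^ k)"
      unfolding P_def poly_sum by (rule sum.cong) (auto simp: poly_monom weight_le_var_0_upd[OF b])
    then show ?thesis using zero[of ?z] by simp
  qed
  then have "P = 0" using poly_all_0_iff_0[of P] by simp
  moreover have "coeff P k = b k z" using k by (simp add: P_def coeff_sum)
  ultimately show "b k z = 0" by simp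
qed

text \<open>Polynomials of degree at most \<open>d\<close> in the \<open>i\<close>-th variable have \<open>d + 1\<close> coefficients, so any
  \<open>d + 2\<close> of them are linearly dependent over the domain of polynomials free of this variable.\<close>

lemma var_linear_dependence:
  fixes g :: "'j \<Rightarrow> complex ^ 'n \<Rightarrow> complex"
  assumes G: "finite G" "Suc d < card G"
    and g: "\<And>j. j \<in> G \<Longrightarrow> weight_le (var_weight i) d (g j)"
  obtains x where "\<And>j. j \<in> G \<Longrightarrow> weight_le (var_weight i) 0 (x j)"
    "\<exists>j\<in>G. x j \<noteq> (\<lambda>z. 0)" "\<And>z. (\<Sum>j\<in>G. x j z * g j z) = 0"
proof -
  let ?B = "{f. weight_le (var_weight i) 0 f}"
  have "\<forall>j\<in>G. \<exists>b. (\<forall>k. b k \<in> ?B) \<and> (\<forall>z. g j z = (\<Sum>k\<le>d. b k z * z $ i ^ k))"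
  proof
    fix j assume "j \<in> G"
    obtain b where "\<And>k. weight_le (var_weight i) 0 (b k)"
        "\<And>z. g j z = (\<Sum>k\<le>d. b k z * z $ i ^ k)"
      using weight_le_var_coefficients[OF g[OF \<open>j \<in> G\<close>]] by blast
    then show "\<exists>b. (\<forall>k. b k \<in> ?B) \<and> (\<forall>z. g j z = (\<Sum>k\<le>d. b k z * z $ i ^ k))"
      by (intro exI[of _ b]) simp
  qed
  from bchoice[OF this] obtain b where
    "\<forall>j\<in>G. (\<forall>k. b j k \<in> ?B) \<and> (\<forall>z. g j z = (\<Sum>k\<le>d. b j k z * z $ i ^ k))" ..
  then have b: "\<And>j k. j \<in> G \<Longrightarrow> b j k \<in> ?B"
      "\<And>j z. j \<in> G \<Longrightarrow> g j z = (\<Sum>k\<le>d. b j k z * z $ i ^ k)"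
    by blast+
  have "\<exists>x. (\<forall>j\<in>G. x j \<in> ?B) \<and> (\<exists>j\<in>G. x j \<noteq> 0) \<and>
      (\<forall>k\<in>{..d}. (\<Sum>j\<in>G. x j * b j k) = 0)"
  proof (rule homogeneous_system_solvable)
    fix f h :: "complex ^ 'n \<Rightarrow> complex" assume fh: "f \<in> ?B" "h \<in> ?B"
    show "f - h \<in> ?B" using weight_le_diff[of "var_weight i" 0 f h] fh by (simp add: fun_diff_def)
    show "f * h \<in> ?B" using weight_le_mult[of "var_weight i" 0 f 0 h] fh by (simp add: func_times)
    show "f = 0 \<or> h = 0" if "f * h = 0"
      using polynomial_maps_no_zero_divisors[of f h] fh that polynomial_map_weight_le
      by (auto simp: func_times func_zero)
  qed (use G b(1) weight_le_const[of "var_weight i" 0 1] in \<open>auto simp: func_one\<close>)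
  then obtain x where x: "\<And>j. j \<in> G \<Longrightarrow> x j \<in> ?B" "\<exists>j\<in>G. x j \<noteq> 0"
      "\<And>k. k \<le> d \<Longrightarrow> (\<Sum>j\<in>G. x j * b j k) = 0" by auto
  have sum_apply: "(\<Sum>j\<in>G. h j) z = (\<Sum>j\<in>G. h j z)"
    for h :: "'j \<Rightarrow> complex ^ 'n \<Rightarrow> complex" and z
    using G(1) by (induction G rule: finite_induct) auto
  have "(\<Sum>j\<in>G. x j z * g j z) = 0" for z
  proof -
    have "(\<Sum>j\<in>G. x j z * g j z) = (\<Sum>j\<in>G. \<Sum>k\<le>d. x j z * b j k z * z $ i ^ k)"
      by (intro sum.cong refl) (simp add: b(2) sum_distrib_left mult_ac)
    also have "\<dots> = (\<Sum>k\<le>d. (\<Sum>j\<in>G. x j z * b j k z) * z $ i ^ k)"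
      by (subst sum.swap) (simp add: sum_distrib_right)
    also have "\<dots> = 0"
    proof (intro sum.neutral ballI)
      fix k assume "k \<in> {..d}"
      then show "(\<Sum>j\<in>G. x j z * b j k z) * z $ i ^ k = 0"
        using fun_cong[OF x(3)[of k], of z] by (simp add: sum_apply)
    qed
    finally show ?thesis .
  qed
  then show ?thesis using that[of x] x(1,2) by (simp add: func_zero)
qed

text \<open>This is the argument behind the resultant.  For a pair \<open>p, q\<close> of degrees \<open>m\<close> and \<open>d\<close>, with \<open>d > 0\<close>
  minimal, consider \<open>p\<close> times the first \<open>d\<close> powers of the variable, \<open>q\<close> times the first \<open>m\<close> powers,
  and the constant \<open>1\<close>: these are \<open>d + m + 1\<close> polynomials of degree less than \<open>d + m\<close>.  A linear
  dependence between them reads \<open>a * p + b * q + y = 0\<close> with \<open>y\<close> free of the variable and \<open>a\<close> of degree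
  less than \<open>d\<close>.  If \<open>y = 0\<close>, then \<open>- b\<close> and \<open>a\<close> would represent \<open>f\<close> with a smaller denominator,
  unless \<open>a\<close>, \<open>b\<close> and with them all coefficients vanish.  So \<open>y \<noteq> 0\<close>, and \<open>y\<close> vanishes wherever
  \<open>p\<close> and \<open>q\<close> do.\<close>

lemma singular_set_eliminate_variable:
  fixes f :: "complex ^ 'n \<Rightarrow> complex"
  assumes f: "continuous_on polydisc f" and bdd: "bounded (f ` polydisc)"
    and rat: "rational_on_polydisc f"
  obtains r where "weight_le (var_weight i) 0 r" "r \<noteq> (\<lambda>z. 0)"
    "\<And>\<zeta>. \<zeta> \<in> singular_set f \<Longrightarrow> r \<zeta> = 0"
proof -
  define has_denom where
    "has_denom d \<longleftrightarrow> (\<exists>p q. fraction_on_polydisc f p q \<and> weight_le (var_weight i) d q)" for d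
  obtain p0 q0 where "fraction_on_polydisc f p0 q0"
    using rational_on_polydisc_fraction[OF f rat] by blast
  then have "\<exists>d. has_denom d"
    unfolding has_denom_def fraction_on_polydisc_def
    using polynomial_map_iff_weight_le[of q0 "var_weight i"] by blast
  define d where "d = (LEAST d. has_denom d)"
  have "has_denom d" unfolding d_def using LeastI_ex[OF \<open>\<exists>d. has_denom d\<close>] .
  then obtain p q where pq: "fraction_on_polydisc f p q" and q: "weight_le (var_weight i) d q"
    unfolding has_denom_def by blast
  obtain m where p: "weight_le (var_weight i) m p"
    using pq polynomial_map_iff_weight_le[of p "var_weight i"] unfolding fraction_on_polydisc_def by blast
  note zeros = singular_set_subset_zeros[OF f bdd pq]
  have q_nz: "q \<noteq> (\<lambda>z. 0)" using pq unfolding fraction_on_polydisc_def by blast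
  show thesis
  proof (cases "d = 0")
    case True
    then show thesis using that[of q] q q_nz zeros by blast
  next
    case False
    define g where "g j z = (if j < d then z $ i ^ j * p z
        else if j < d + m then z $ i ^ (j - d) * q z else 1)" for j z
    have pow: "weight_le (var_weight i) j (\<lambda>z. z $ i ^ j)" for j
      using weight_le_power[OF weight_le_coord[of "var_weight i" i 1], of j] by simp
    have g_le: "weight_le (var_weight i) (d + m - 1) (g j)" for j
    proof -
      consider "j < d" | "d \<le> j" "j < d + m" | "d + m \<le> j" by linarith
      then show ?thesis
      proof cases
        case 1
        then have "g j = (\<lambda>z. z $ i ^ j * p z)" by (auto simp: g_def)
        then show ?thesis using weight_le_mono[OF weight_le_mult[OF pow[of j] p]] 1 by simp
      next
        case 2
        then have "g j = (\<lambda>z. z $ i ^ (j - d) * q z)" by (auto simp: g_def)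
        then show ?thesis using weight_le_mono[OF weight_le_mult[OF pow[of "j - d"] q]] 2 by simp
      next
        case 3
        then have "g j = (\<lambda>z. 1)" by (auto simp: g_def)
        then show ?thesis using weight_le_const by simp
      qed
    qed
    obtain x where x: "\<And>j. j < Suc (d + m) \<Longrightarrow> weight_le (var_weight i) 0 (x j)"
        "\<exists>j<Suc (d + m). x j \<noteq> (\<lambda>z. 0)" "\<And>z. (\<Sum>j<Suc (d + m). x j z * g j z) = 0"
    proof (rule var_linear_dependence[where G = "{..<Suc (d + m)}" and d = "d + m - 1" and g = g])
      show "Suc (d + m - 1) < card {..<Suc (d + m)}" using False by simp
    qed (use g_le in auto)
    define a where "a z = (\<Sum>j<d. x j z * z $ i ^ j)" for z
    define b where "b z = (\<Sum>j<m. x (d + j) z * z $ i ^ j)" for z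
    define y where "y = x (d + m)"
    have "(\<Sum>j<d + m. h j) = (\<Sum>j<d. h j) + (\<Sum>j<m. h (d + j))" for h :: "nat \<Rightarrow> complex"
      by (induction m) (auto simp: add_ac)
    then have rel: "a z * p z + b z * q z + y z = 0" for z
      using x(3)[of z] by (simp add: a_def b_def y_def g_def sum_distrib_left mult_ac)
    have a_le: "weight_le (var_weight i) (d - 1) a"
      unfolding a_def[abs_def]
    proof (rule weight_le_sum)
      fix j assume "j \<in> {..<d}"
      then show "weight_le (var_weight i) (d - 1) (\<lambda>z. x j z * z $ i ^ j)"
        by (intro weight_le_mono[OF weight_le_mult[OF x(1) pow]]) auto
    qed
    have b_poly: "polynomial_map b"
      unfolding b_def[abs_def]
      by (intro polynomial_map_sum polynomial_map_mult polynomial_map_power polynomial_map_coord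
          polynomial_map_weight_le[OF x(1)]) auto
    show thesis
    proof (cases "y = (\<lambda>z. 0)")
      case False
      have "y \<zeta> = 0" if "\<zeta> \<in> singular_set f" for \<zeta> using rel[of \<zeta>] zeros[OF that] by simp
      then show thesis using that[of y] x(1)[of "d + m"] False by (simp add: y_def)
    next
      case y0: True
      show thesis
      proof (cases "a = (\<lambda>z. 0)")
        case False
        have "fraction_on_polydisc f (\<lambda>z. - b z) a"
        proof (rule fraction_on_polydisc_cross_multiply[OF f pq _ polynomial_map_weight_le[OF a_le] False])
          show "polynomial_map (\<lambda>z. - b z)"
            using polynomial_map_mult[OF polynomial_map_const[of "-1"] b_poly] by simp
          show "a z * p z = - b z * q z" for z
            using rel[of z] y0 by (simp add: eq_neg_iff_add_eq_0)
        qed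
        then have "has_denom (d - 1)" unfolding has_denom_def using a_le by blast
        then have "d \<le> d - 1" unfolding d_def by (rule Least_le)
        then show thesis using \<open>d \<noteq> 0\<close> by simp
      next
        case a0: True
        have "(\<lambda>z. b z * q z) = (\<lambda>z. 0)" using rel y0 a0 by (simp add: fun_eq_iff)
        then have b0: "b = (\<lambda>z. 0)"
          using polynomial_maps_no_zero_divisors[OF b_poly polynomial_map_weight_le[OF q]] q_nz by blast
        have "x j = (\<lambda>z. 0)" if j: "j < Suc (d + m)" for j
        proof -
          consider "j < d" | "d \<le> j" "j < d + m" | "j = d + m" using j by linarith
          then show ?thesis
          proof cases
            case 1
            show ?thesis
              by (rule var_coefficients_unique[OF _ _ 1]) (use x(1) fun_cong[OF a0] in \<open>auto simp: a_def\<close>)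
          next
            case 2
            have "x (d + (j - d)) = (\<lambda>z. 0)"
              by (rule var_coefficients_unique[where b = "\<lambda>j. x (d + j)" and d = m])
                (use x(1) fun_cong[OF b0] 2 in \<open>auto simp: b_def\<close>)
            then show ?thesis using 2 by simp
          next
            case 3
            then show ?thesis using y0 by (simp add: y_def)
          qed
        qed
        then show thesis using x(2) by blast
      qed
    qed
  qed
qed

section \<open>The algebraic set\<close>

text \<open>For \<open>n = 1\<close> the upper bound excludes every chain and the dimension is the inserted value
  \<open>- 1 = n - 2\<close>.\<close>

lemma alg_dim_eqI:
  fixes V :: "(complex ^ 'n) set"
  assumes upper: "\<And>k Z. irreducible_chain V k Z \<Longrightarrow> k + 2 \<le> CARD('n)"
    and lower: "CARD('n) \<ge> 2 \<Longrightarrow> \<exists>Z. irreducible_chain V (CARD('n) - 2) Z"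
  shows "alg_dim V = ereal (real CARD('n) - 2)"
  unfolding alg_dim_def
proof (rule antisym)
  have pos: "CARD('n) \<ge> 1" by (simp add: Suc_leI)
  show "Sup (insert (- 1) {ereal (real k) |k. \<exists>Z. irreducible_chain V k Z}) \<le> ereal (real CARD('n) - 2)"
  proof (rule Sup_least)
    fix d assume "d \<in> insert (- 1) {ereal (real k) |k. \<exists>Z. irreducible_chain V k Z}"
    then consider "d = ereal (- 1)" | k Z where "d = ereal (real k)" "irreducible_chain V k Z"
      by (auto simp: one_ereal_def)
    then show "d \<le> ereal (real CARD('n) - 2)"
    proof cases
      case 1
      then show ?thesis using pos by simp
    next
      case 2
      then show ?thesis using upper[OF 2(2)] by simp
    qed
  qed
  show "ereal (real CARD('n) - 2) \<le> Sup (insert (- 1) {ereal (real k) |k. \<exists>Z. irreducible_chain V k Z})"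
  proof (rule Sup_upper)
    show "ereal (real CARD('n) - 2) \<in> insert (- 1) {ereal (real k) |k. \<exists>Z. irreducible_chain V k Z}"
    proof (cases "CARD('n) \<ge> 2")
      case True
      then have "ereal (real CARD('n) - 2) = ereal (real (CARD('n) - 2))" by simp
      then show ?thesis using lower[OF True] by blast
    next
      case False
      then have "CARD('n) = 1" using pos by linarith
      then show ?thesis by (simp add: one_ereal_def)
    qed
  qed
qed

theorem proposition3p6:
  fixes \<phi> :: "complex ^ 'n \<Rightarrow> complex"
  assumes "rational_inner_function \<phi>"
  shows "\<exists>V :: (complex ^ 'n) set.
           algebraic_set V \<and> alg_dim V = ereal (real CARD('n) - 2) \<and> singular_set \<phi> \<subseteq> V"
proof -
  have cont: "continuous_on polydisc \<phi>" and bdd: "bounded (\<phi> ` polydisc)"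
    and rat: "rational_on_polydisc \<phi>"
    using assms holomorphic_polydisc_continuous_on
    unfolding rational_inner_function_def inner_function_def by blast+
  have "\<forall>i. \<exists>r. weight_le (var_weight i) 0 r \<and> r \<noteq> (\<lambda>z. 0) \<and> (\<forall>\<zeta>\<in>singular_set \<phi>. r \<zeta> = 0)"
    using singular_set_eliminate_variable[OF cont bdd rat] by metis
  from choice[OF this] obtain r where r: "\<forall>i. weight_le (var_weight i) 0 (r i) \<and>
      r i \<noteq> (\<lambda>z. 0) \<and> (\<forall>\<zeta>\<in>singular_set \<phi>. r i \<zeta> = 0)" ..
  obtain s :: "'n \<Rightarrow> complex ^ 'n \<Rightarrow> complex" where
    s: "\<And>i. weight_le (var_weight i) 0 (s i)" "\<And>i. s i \<noteq> (\<lambda>z. 0)"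
    and chain: "2 \<le> CARD('n) \<Longrightarrow> \<exists>Z. irreducible_chain {z. \<forall>i. r i z * s i z = 0} (CARD('n) - 2) Z"
  proof (cases "2 \<le> CARD('n)")
    case False
    show thesis
      by (rule that[of "\<lambda>i z. 1"]) (use False in \<open>auto simp: fun_eq_iff intro: weight_le_const\<close>)
  next
    case True
    then obtain T :: "'n set" where "card T = 2" "finite T"
      by (metis obtain_subset_with_card_n)
    then obtain a b where ab: "T = {a, b}" "a \<noteq> b" by (auto simp: card_2_iff)
    \<comment> \<open>A coordinate other than \<open>i\<close> that vanishes on the subspace where coordinates \<open>a\<close> and \<open>b\<close> are \<open>0\<close>.\<close>
    define v where "v i = (if i = a then b else a)" for i
    let ?s = "\<lambda>i (z :: complex ^ 'n). z $ v i"
    show thesis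
    proof (rule that[of ?s])
      show "weight_le (var_weight i) 0 (?s i)" for i
        by (rule weight_le_coord) (use ab in \<open>auto simp: v_def\<close>)
      show "?s i \<noteq> (\<lambda>z. 0)" for i by (auto simp: fun_eq_iff intro!: exI[of _ "1"])
      have card: "card (- T) = CARD('n) - 2" using \<open>card T = 2\<close> \<open>finite T\<close>
        by (simp add: Compl_eq_Diff_UNIV card_Diff_subset)
      have sub: "{z. \<forall>j\<in>- (- T). z $ j = 0} \<subseteq> {z. \<forall>i. r i z * ?s i z = 0}"
        using ab by (auto simp: v_def)
      from coordinate_subspace_chain[OF finite_class.finite card sub]
      show "\<exists>Z. irreducible_chain {z. \<forall>i. r i z * ?s i z = 0} (CARD('n) - 2) Z"
        by (rule ex_forward) (rule conjunct1)
    qed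
  qed
  let ?V = "{z. \<forall>i. r i z * s i z = 0}"
  have rs: "weight_le (var_weight i) 0 (\<lambda>z. r i z * s i z)" "(\<lambda>z. r i z * s i z) \<noteq> (\<lambda>z. 0)" for i
  proof -
    have ri: "weight_le (var_weight i) 0 (r i)" "r i \<noteq> (\<lambda>z. 0)" using r by blast+
    show "weight_le (var_weight i) 0 (\<lambda>z. r i z * s i z)"
      using weight_le_mult[OF ri(1) s(1)] by simp
    show "(\<lambda>z. r i z * s i z) \<noteq> (\<lambda>z. 0)"
      by (rule polynomial_maps_no_zero_divisors[OF polynomial_map_weight_le[OF ri(1)]
            polynomial_map_weight_le[OF s(1)] ri(2) s(2)])
  qed
  have "algebraic_set ?V"
    unfolding algebraic_set_def
    by (intro exI[of _ "range (\<lambda>i z. r i z * s i z)"])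
      (auto intro: polynomial_map_weight_le[OF rs(1)])
  moreover have "alg_dim ?V = ereal (real CARD('n) - 2)"
    by (rule alg_dim_eqI[OF chain_length_bound[where r = "\<lambda>i z. r i z * s i z", OF rs] chain])
  moreover have "singular_set \<phi> \<subseteq> ?V" using r by auto
  ultimately show ?thesis by blast
qed

end
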